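(* Let $0<p\leq q<\infty$ and let $g,\psi$ be nonconstant entire functions on $\mathbb{C}$. Define $$M_{(g,\psi)}(z)=\frac{|g'(z)|}{1+|z|}e^{\frac12(|\psi(z)|^2-|z|^2)},\qquad \widetilde M_{(g,\psi)}(z)=\frac{|g(z)|(1+|\psi(z)|)}{1+|z|}e^{\frac12(|\psi(z)|^2-|z|^2)}.$$ Then: (i) $V_{(g,\psi)}:\mathcal{F}_p\to\mathcal{F}_q$ is bounded if and only if $M_{(g,\psi)}\in L^\infty(\mathbb{C},dA)$; (ii) $V_{(g,\psi)}:\mathcal{F}_p\to\mathcal{F}_q$ is compact if and only if $\lim_{|z|\to\infty}M_{(g,\psi)}(z)=0$; (iii) $J_{(g,\psi)}:\mathcal{F}_p\to\mathcal{F}_q$ is bounded if and only if $\widetilde M_{(g,\psi)}\in L^\infty(\mathbb{C},dA)$; (iv) $J_{(g,\psi)}:\mathcal{F}_p\to\mathcal{F}_q$ is compact if and only if $\lim_{|z|\to\infty}\widetilde M_{(g,\psi)}(z)=0$.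
   Context: $dA$ is Lebesgue area measure on $\mathbb{C}$. For $0<p<\infty$, the Fock space $\mathcal{F}_p$ is the space of entire functions $f$ with $\|f\|_p^p=\frac{p}{2\pi}\int_{\mathbb{C}}|f(z)|^pe^{-\frac p2|z|^2}\,dA(z)<\infty$. For entire $g,\psi$, the generalized Volterra-type operators are $V_{(g,\psi)}f(z)=\int_0^z f(\psi(w))g'(w)\,dw$ and $J_{(g,\psi)}f(z)=\int_0^z f'(\psi(w))g(w)\,dw$. *)

theory Defs
  imports "HOL-Complex_Analysis.Complex_Analysis"
begin

definition fock_integral :: "real \<Rightarrow> (complex \<Rightarrow> complex) \<Rightarrow> ennreal" where
  "fock_integral p f =
     ennreal (p / (2 * pi)) *
     (\<integral>\<^sup>+ z. ennreal (norm (f z) powr p * exp (- (p / 2) * (norm z)\<^sup>2)) \<partial>lborel)"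

definition in_fock :: "real \<Rightarrow> (complex \<Rightarrow> complex) \<Rightarrow> bool" where
  "in_fock p f \<longleftrightarrow> f holomorphic_on UNIV \<and> fock_integral p f < \<infinity>"

definition fock_norm :: "real \<Rightarrow> (complex \<Rightarrow> complex) \<Rightarrow> real" where
  "fock_norm p f = (enn2real (fock_integral p f)) powr (1 / p)"

definition V_op :: "(complex \<Rightarrow> complex) \<Rightarrow> (complex \<Rightarrow> complex) \<Rightarrow> (complex \<Rightarrow> complex) \<Rightarrow> complex \<Rightarrow> complex" where
  "V_op g \<psi> f z = contour_integral (linepath 0 z) (\<lambda>w. f (\<psi> w) * deriv g w)"

definition J_op :: "(complex \<Rightarrow> complex) \<Rightarrow> (complex \<Rightarrow> complex) \<Rightarrow> (complex \<Rightarrow> complex) \<Rightarrow> complex \<Rightarrow> complex" where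
  "J_op g \<psi> f z = contour_integral (linepath 0 z) (\<lambda>w. deriv f (\<psi> w) * g w)"

definition fock_bounded :: "real \<Rightarrow> real \<Rightarrow> ((complex \<Rightarrow> complex) \<Rightarrow> (complex \<Rightarrow> complex)) \<Rightarrow> bool" where
  "fock_bounded p q T \<longleftrightarrow>
     (\<exists>C. \<forall>f. in_fock p f \<longrightarrow> in_fock q (T f) \<and> fock_norm q (T f) \<le> C * fock_norm p f)"

definition fock_compact :: "real \<Rightarrow> real \<Rightarrow> ((complex \<Rightarrow> complex) \<Rightarrow> (complex \<Rightarrow> complex)) \<Rightarrow> bool" where
  "fock_compact p q T \<longleftrightarrow>
     (\<forall>f. in_fock p f \<longrightarrow> in_fock q (T f)) \<and>
     (\<forall>fs :: nat \<Rightarrow> complex \<Rightarrow> complex.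
        (\<forall>n. in_fock p (fs n)) \<and> (\<exists>B. \<forall>n. fock_norm p (fs n) \<le> B) \<longrightarrow>
        (\<exists>r h. strict_mono r \<and> in_fock q h \<and>
               ((\<lambda>n. fock_norm q (\<lambda>z. T (fs (r n)) z - h z)) \<longlongrightarrow> 0) sequentially))"

definition ess_bounded :: "(complex \<Rightarrow> real) \<Rightarrow> bool" where
  "ess_bounded M \<longleftrightarrow> (\<exists>C. AE z in lborel. \<bar>M z\<bar> \<le> C)"

definition M_fun :: "(complex \<Rightarrow> complex) \<Rightarrow> (complex \<Rightarrow> complex) \<Rightarrow> complex \<Rightarrow> real" where
  "M_fun g \<psi> z = norm (deriv g z) / (1 + norm z) * exp ((norm (\<psi> z)^2 - norm z ^ 2) / 2)"

definition Mt_fun :: "(complex \<Rightarrow> complex) \<Rightarrow> (complex \<Rightarrow> complex) \<Rightarrow> complex \<Rightarrow> real" where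
  "Mt_fun g \<psi> z = norm (g z) * (1 + norm (\<psi> z)) / (1 + norm z) *
                    exp ((norm (\<psi> z)^2 - norm z ^ 2) / 2)"

end

theory Submission
  imports Defs "HOL-Probability.Distributions" "HOL-Real_Asymp.Real_Asymp"
begin

text \<open>
  Both operators are primitives of \<open>D f \<circ> \<psi> \<cdot> u\<close> with \<open>D\<close> the identity or the derivative. Write
  \<open>N(x) = |F'(x)| exp(-|x|\<^sup>2/2) / (1 + |x|)\<close>. For every exponent \<open>q > 0\<close>, the integral of \<open>N\<^sup>q\<close> dominates
  the \<open>q\<close>-th power of the Fock norm of an entire \<open>F\<close> with \<open>F 0 = 0\<close>, and \<open>N\<close> is pointwise dominated by the
  Fock norm. For \<open>F = T f\<close>, \<open>N\<close> is the product of the symbol \<open>M\<close> (respectively its counterpart for \<open>J\<close>) with the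
  normalised size of \<open>D f\<close> at \<open>\<psi> x\<close>.

  Necessity: test \<open>T\<close> on normalised kernels centred at \<open>\<psi> z\<close>; for compactness, the limit function has \<open>N\<close>
  vanishing at infinity, hence so does the symbol along any sequence.
  Sufficiency: a bounded symbol forces \<open>\<psi> z = a z + b\<close> with \<open>a \<noteq> 0\<close>, so the preimages of unit discs
  under \<open>\<psi>\<close> have bounded area and the integral of \<open>N\<^sup>q\<close> is controlled by Tonelli's theorem; compactness follows by
  Montel's theorem, splitting the integral at a large radius.
\<close>

subsection \<open>Local mean-value estimates for powers of entire functions\<close>

text \<open>Two obstacles shape the proof. For exponents below 1, Jensen's inequality points the
  wrong way and the Fock norm is not subadditive. Hence the power of an integral along a segment is
  replaced by the power of a maximum, which is then compared with a mean over a unit disc, and sums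
  are estimated through a maximum. All inequalities are one-sided with crude constants: the
  comparison of \<open>F\<close> with its derivative appears as an integral inequality in one
  direction and only pointwise in the other. Secondly, composition with \<open>\<psi>\<close> must
  not inflate integrals. For a general entire \<open>\<psi>\<close> the preimage of a unit disc may
  have infinite area, so the rigidity of \<open>\<psi>\<close> has to precede the norm estimates. It
  rests on the exponential factor of the symbol alone: on circles of radius \<open>r\<close> a
  quadratic term in \<open>\<psi>\<close> would force growth like the exponential of a multiple of
  \<open>r ^ 4\<close>, while the bound allows only that of a quadratic polynomial.\<close>

lemma nn_integral_gaussian_complex_finite:
  fixes c :: real
  assumes "c > 0"
  shows "(\<integral>\<^sup>+ z. ennreal (exp (- c * (norm (z::complex))\<^sup>2)) \<partial>lborel) < \<infinity>"
proof -
  have 1: "(\<integral>\<^sup>+ x. ennreal (exp (- c * x\<^sup>2)) \<partial>lborel) < \<infinity>"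
  proof -
    define s where "s = sqrt (1 / (2*c))"
    have s: "s > 0" "s\<^sup>2 = 1/(2*c)" using assms by (auto simp: s_def)
    have eq: "exp (- c * x\<^sup>2) = sqrt (2 * pi * s\<^sup>2) * normal_density 0 s x" for x :: real
      using s assms by (simp add: normal_density_def field_simps)
    have "integrable lborel (\<lambda>x. sqrt (2*pi * s\<^sup>2) * normal_density 0 s x)"
      using s by (intro integrable_mult_right) auto
    then have "integrable lborel (\<lambda>x. exp (- c * x\<^sup>2))"
      by (simp only: eq)
    then show ?thesis
      by (simp add: integrable_iff_bounded)
  qed
  have "ennreal (exp (- c * (norm z)\<^sup>2)) = (\<Prod>b\<in>Basis. ennreal (exp (- c * (z \<bullet> b)\<^sup>2)))" for z :: complex
    by (simp add: Basis_complex_def cmod_power2 exp_add [symmetric] ennreal_mult [symmetric] algebra_simps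
             flip: exp_add)
  then have "(\<integral>\<^sup>+ z. ennreal (exp (- c * (norm (z::complex))\<^sup>2)) \<partial>lborel)
     = (\<Prod>b\<in>(Basis::complex set). (\<integral>\<^sup>+ x. ennreal (exp (- c * x\<^sup>2)) \<partial>lborel))"
    by (simp only:) (rule nn_integral_lborel_prod, auto)
  also have "\<dots> < \<infinity>"
    using 1 by (simp add: Basis_complex_def ennreal_mult_less_top)
  finally show ?thesis .
qed

lemma nn_integral_lborel_shift:
  fixes f :: "'a::euclidean_space \<Rightarrow> ennreal"
  assumes "f \<in> borel_measurable borel"
  shows "(\<integral>\<^sup>+ z. f (c + z) \<partial>lborel) = (\<integral>\<^sup>+ z. f z \<partial>lborel)"
proof -
  have "(\<integral>\<^sup>+ z. f z \<partial>lborel) = (\<integral>\<^sup>+ z. f z \<partial>distr lborel borel ((+) c))"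
    by (simp add: lborel_distr_plus)
  also have "\<dots> = (\<integral>\<^sup>+ z. f (c + z) \<partial>lborel)"
    using assms by (subst nn_integral_distr) auto
  finally show ?thesis by simp
qed

text \<open>Schur's test for exponent 1: after Tonelli only the integrals of \<open>k\<close> in its
  first variable matter. \<open>G\<close> is later a \<open>q\<close>-th power, so the test serves
  every \<open>q\<close>; the kernels are a Gaussian and the indicator of
  \<open>dist (\<psi> z) v < 1\<close>.\<close>

lemma nn_integral_schur:
  fixes k :: "complex \<Rightarrow> complex \<Rightarrow> ennreal" and G :: "complex \<Rightarrow> ennreal"
  assumes k: "case_prod k \<in> borel_measurable (lborel \<Otimes>\<^sub>M lborel)"
    and G [measurable]: "G \<in> borel_measurable lborel"
    and A: "\<And>v. (\<integral>\<^sup>+ z. k z v \<partial>lborel) \<le> A"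
  shows "(\<integral>\<^sup>+ z. (\<integral>\<^sup>+ v. k z v * G v \<partial>lborel) \<partial>lborel) \<le> A * (\<integral>\<^sup>+ v. G v \<partial>lborel)"
proof -
  have m: "(\<lambda>(z,v). k z v * G v) \<in> borel_measurable (lborel \<Otimes>\<^sub>M lborel)"
    using k by (simp add: case_prod_unfold)
  have [measurable]: "(\<lambda>z. k z v) \<in> borel_measurable lborel" for v
    using measurable_compose [OF measurable_Pair2' k, of v] by simp
  have "(\<integral>\<^sup>+ z. (\<integral>\<^sup>+ v. k z v * G v \<partial>lborel) \<partial>lborel) = (\<integral>\<^sup>+ v. (\<integral>\<^sup>+ z. k z v * G v \<partial>lborel) \<partial>lborel)"
    using lborel_pair.Fubini' [OF m] by simp
  also have "\<dots> = (\<integral>\<^sup>+ v. (\<integral>\<^sup>+ z. k z v \<partial>lborel) * G v \<partial>lborel)"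
    by (intro nn_integral_cong nn_integral_multc) auto
  also have "\<dots> \<le> (\<integral>\<^sup>+ v. A * G v \<partial>lborel)"
    by (intro nn_integral_mono mult_right_mono A) auto
  also have "\<dots> = A * (\<integral>\<^sup>+ v. G v \<partial>lborel)"
    by (intro nn_integral_cmult) auto
  finally show ?thesis .
qed

text \<open>Cauchy's inequality on circles of radius \<open>d/2\<close> bounds the derivative by
  \<open>2 * L * norm (F z0) / d\<close> within distance \<open>d/4\<close> of \<open>z0\<close>. A
  displacement of at most \<open>d / (4 * L)\<close> therefore changes \<open>F\<close> by at most
  half of \<open>norm (F z0)\<close>.\<close>

lemma holomorphic_near_constant_around_max:
  fixes F :: "complex \<Rightarrow> complex"
  assumes F: "F holomorphic_on UNIV" and d: "d > 0" and L: "L \<ge> 1"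
    and b: "\<And>z. dist z0 z \<le> d \<Longrightarrow> norm (F z) \<le> L * norm (F z0)"
    and z: "dist z0 z \<le> d / (4 * L)"
  shows "norm (F z0) / 2 \<le> norm (F z)"
proof -
  have dL: "d / (4*L) \<le> d / 4" using d L by (simp add: field_simps)
  have B: "norm (deriv F x) \<le> L * norm (F z0) / (d/2)" if "x \<in> cball z0 (d/4)" for x
  proof -
    have "norm ((deriv ^^ 1) F x) \<le> fact 1 * (L * norm (F z0)) / (d/2)^1"
    proof (rule Cauchy_inequality)
      show "F holomorphic_on ball x (d/2)" using F holomorphic_on_subset by blast
      show "continuous_on (cball x (d/2)) F"
        using F holomorphic_on_imp_continuous_on holomorphic_on_subset by blast
      show "norm (F y) \<le> L * norm (F z0)" if "norm (x - y) = d/2" for y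
      proof (rule b)
        have "dist z0 y \<le> dist z0 x + dist x y" by (rule dist_triangle)
        then show "dist z0 y \<le> d" using that \<open>x \<in> cball z0 (d/4)\<close> d by (simp add: dist_norm)
      qed
    qed (use d in auto)
    then show ?thesis by simp
  qed
  have "norm (F z - F z0) \<le> L * norm (F z0) / (d/2) * norm (z - z0)"
  proof (rule field_differentiable_bound [of "cball z0 (d/4)" F "deriv F"])
    show "(F has_field_derivative deriv F x) (at x within cball z0 (d/4))" for x
      using F by (simp add: holomorphic_derivI has_field_derivative_at_within)
    show "z \<in> cball z0 (d/4)" using z dL by auto
  qed (use B d in auto)
  also have "\<dots> \<le> L * norm (F z0) / (d/2) * (d / (4*L))"
    using z d L by (intro mult_left_mono) (auto simp: dist_norm norm_minus_commute)
  also have "\<dots> = norm (F z0) / 2"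
    using d L by (simp add: field_simps)
  finally have "norm (F z - F z0) \<le> norm (F z0) / 2" .
  moreover have "norm (F z0) \<le> norm (F z) + norm (F z - F z0)"
    by (metis norm_triangle_sub norm_minus_commute)
  ultimately show ?thesis by simp
qed

text \<open>For \<open>q < 1\<close> Jensen's inequality is not available. Instead, where \<open>(1 - \<bar>z\<bar>)\<^sup>2 \<bar>F z\<bar>\<^sup>q\<close> is maximal,
  Cauchy's inequality keeps \<open>\<bar>F\<bar>\<close> comparable to its value on a disc of radius proportional to \<open>1 - \<bar>z\<bar>\<close>.\<close>

lemma entire_local_power_bound:
  fixes q :: real
  assumes q: "q > 0"
  obtains C where "C > 0"
    "\<And>F z. F holomorphic_on UNIV \<Longrightarrow> norm (z::complex) \<le> 1/2 \<Longrightarrow>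
       ennreal (norm (F z) powr q) \<le> ennreal C * (\<integral>\<^sup>+ \<zeta>\<in>ball 0 1. ennreal (norm (F \<zeta>) powr q) \<partial>lborel)"
proof
  \<comment> \<open>With \<open>s = 2 / q\<close> the \<open>q\<close>-th power of
    \<open>\<phi>\<close> carries the square of \<open>1 - norm z\<close>, which matches the area of
    a disc of comparable radius. \<open>L\<close> is the loss when \<open>1 - norm z\<close> is
    halved. In \<open>C\<close>, \<open>2 powr q\<close> pays for halving
    \<open>norm (F z0)\<close>; \<open>256 * L\<^sup>2\<close> comes from
    \<open>16 * d\<^sup>2 = 256 * L\<^sup>2 * \<rho>\<^sup>2\<close>.\<close>
  define s where "s = 2 / q"
  define L where "L = 2 powr s"
  define C where "C = 2 powr q * 256 * L\<^sup>2 / pi"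
  have s: "s > 0" and L: "L \<ge> 1" using q by (auto simp: s_def L_def ge_one_powr_ge_zero)
  then show "C > 0" by (simp add: C_def)
  fix F :: "complex \<Rightarrow> complex" and z :: complex
  assume F: "F holomorphic_on UNIV" and z: "norm z \<le> 1/2"
  have cF: "continuous_on A F" for A
    using F holomorphic_on_imp_continuous_on continuous_on_subset by blast
  define \<phi> where "\<phi> = (\<lambda>z. (1 - norm z) powr s * norm (F z))"
  have "continuous_on (cball 0 1) \<phi>"
    unfolding \<phi>_def using s
    by (intro continuous_intros cF continuous_on_powr') auto
  then obtain z0 where z0: "z0 \<in> cball 0 1" and max: "\<And>x. x \<in> cball 0 1 \<Longrightarrow> \<phi> x \<le> \<phi> z0"
    using continuous_attains_sup [of "cball 0 1" \<phi>] by auto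
  let ?I = "\<integral>\<^sup>+ \<zeta>\<in>ball 0 1. ennreal (norm (F \<zeta>) powr q) \<partial>lborel"
  have "(1/2) powr s \<le> (1 - norm z) powr s"
    using z s by (intro powr_mono2) auto
  then have "(1/2) powr s * norm (F z) \<le> (1 - norm z) powr s * norm (F z)"
    by (intro mult_right_mono) auto
  also have "\<dots> \<le> \<phi> z0"
    using max [of z] z by (simp add: \<phi>_def)
  finally have "(1/2) powr s * norm (F z) \<le> \<phi> z0" .
  moreover have "(1/2) powr s = 1 / L" by (simp add: L_def powr_divide)
  ultimately have *: "norm (F z) \<le> L * \<phi> z0"
    using L by (simp add: field_simps)
  show "ennreal (norm (F z) powr q) \<le> ennreal C * ?I"
  proof (cases "\<phi> z0 = 0")
    case True
    then show ?thesis using * by simp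
  next
    case False
    \<comment> \<open>\<open>\<phi>\<close> vanishes on the unit circle, so a positive maximum is
      attained in the open disc.\<close>
    then have nz: "norm z0 < 1" using z0 s by (cases "norm z0 = 1") (auto simp: \<phi>_def)
    define d where "d = (1 - norm z0) / 2"
    have d: "d > 0" and d2: "1 - norm z0 = 2 * d" using nz by (auto simp: d_def)
    have b: "norm (F x) \<le> L * norm (F z0)" if "dist z0 x \<le> d" for x
    proof -
      have nx: "norm x \<le> norm z0 + d"
        using that norm_triangle_sub [of x z0] by (simp add: dist_norm norm_minus_commute)
      have "d powr s \<le> (1 - norm x) powr s"
        using nx s d by (intro powr_mono2) (auto simp: d_def field_simps)
      moreover have "\<phi> x \<le> \<phi> z0" using nx d by (intro max) (auto simp: d_def field_simps)
      ultimately have "d powr s * norm (F x) \<le> (2*d) powr s * norm (F z0)"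
        using mult_right_mono [of "d powr s" "(1 - norm x) powr s" "norm (F x)"] d2
        by (simp add: \<phi>_def)
      also have "(2*d) powr s = L * d powr s"
        using d by (simp add: L_def powr_mult)
      finally show ?thesis using d by (simp add: mult.assoc)
    qed
    define \<rho> where "\<rho> = d / (4*L)"
    have \<rho>: "\<rho> > 0" "\<rho> \<le> d" using d L by (auto simp: \<rho>_def field_simps)
    have sub: "ball z0 \<rho> \<subseteq> ball 0 1"
    proof
      fix x assume "x \<in> ball z0 \<rho>"
      then have "norm x < norm z0 + d"
        using \<rho> norm_triangle_sub [of x z0] by (simp add: dist_norm norm_minus_commute)
      then show "x \<in> ball 0 1" using d by (simp add: d_def field_simps)
    qed
    have "ennreal ((norm (F z0) / 2) powr q * (pi * \<rho>\<^sup>2)) =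
          (\<integral>\<^sup>+ \<zeta>. ennreal ((norm (F z0) / 2) powr q) * indicator (ball z0 \<rho>) \<zeta> \<partial>lborel)"
      using \<rho> by (simp add: nn_integral_cmult_indicator emeasure_ball ennreal_mult unit_ball_vol_2)
    also have "\<dots> \<le> ?I"
    proof (intro nn_integral_mono)
      fix \<zeta>
      have "norm (F z0) / 2 \<le> norm (F \<zeta>)" if "\<zeta> \<in> ball z0 \<rho>"
        using holomorphic_near_constant_around_max [OF F d L b] that by (auto simp: \<rho>_def)
      then show "ennreal ((norm (F z0) / 2) powr q) * indicator (ball z0 \<rho>) \<zeta>
            \<le> ennreal (norm (F \<zeta>) powr q) * indicator (ball 0 1) \<zeta>"
        using sub q by (auto simp: indicator_def intro!: ennreal_leI powr_mono2)
    qed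
    finally have I: "ennreal ((norm (F z0) / 2) powr q * (pi * \<rho>\<^sup>2)) \<le> ?I" .
    have "norm (F z) powr q \<le> (L * \<phi> z0) powr q"
      using * q by (intro powr_mono2) auto
    also have "\<dots> = C * ((norm (F z0) / 2) powr q * (pi * \<rho>\<^sup>2))"
    proof -
      have sq: "(x powr s) powr q = x\<^sup>2" if "x > 0" for x :: real
        using q that by (simp add: powr_powr s_def)
      have "L powr q = 4" by (simp add: L_def sq)
      moreover have "\<phi> z0 powr q = (2*d)\<^sup>2 * norm (F z0) powr q"
        using nz by (simp add: \<phi>_def powr_mult sq d_def)
      moreover have "\<phi> z0 \<ge> 0" by (simp add: \<phi>_def)
      ultimately have "(L * \<phi> z0) powr q = 16 * d\<^sup>2 * norm (F z0) powr q"
        using L by (simp add: powr_mult power2_eq_square)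
      also have "\<dots> = C * ((norm (F z0) / 2) powr q * (pi * \<rho>\<^sup>2))"
        using L d by (simp add: C_def \<rho>_def powr_divide power_divide power_mult_distrib)
      finally show ?thesis .
    qed
    finally have "ennreal (norm (F z) powr q) \<le> ennreal C * ennreal ((norm (F z0) / 2) powr q * (pi * \<rho>\<^sup>2))"
      using \<open>C > 0\<close> by (subst ennreal_mult [symmetric]) (auto intro: ennreal_leI)
    also have "\<dots> \<le> ennreal C * ?I"
      by (intro mult_left_mono I) auto
    finally show ?thesis .
  qed
qed

subsection \<open>The Gaussian weight\<close>

text \<open>The weight carries no exponent, so \<open>gauss_abs f z powr p\<close> is the integrand
  of \<open>fock_integral p\<close> for every \<open>p\<close>.\<close>

definition gauss_abs :: "(complex \<Rightarrow> complex) \<Rightarrow> complex \<Rightarrow> real" where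
  "gauss_abs f z = norm (f z) * exp (- (norm z)\<^sup>2 / 2)"

definition local_mass :: "real \<Rightarrow> (complex \<Rightarrow> complex) \<Rightarrow> complex \<Rightarrow> ennreal" where
  "local_mass q f x = (\<integral>\<^sup>+ v\<in>ball x 1. ennreal (gauss_abs f v powr q) \<partial>lborel)"

lemma ball_measurable [measurable]: "ball x r \<in> sets borel" for x :: "'a::metric_space"
  by simp

lemma one_plus_norm_pos [simp]: "0 < 1 + norm x" "1 + norm x \<noteq> 0" "0 \<le> 1 + norm x"
  for x :: "'a::real_normed_vector"
  by (auto simp: add_pos_nonneg add_nonneg_eq_0_iff)

lemma gauss_abs_nonneg [simp]: "gauss_abs f z \<ge> 0"
  by (simp add: gauss_abs_def)

lemma entire_continuous_on:
  "f holomorphic_on UNIV \<Longrightarrow> continuous_on A f" for f :: "complex \<Rightarrow> complex"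
  using holomorphic_on_imp_continuous_on continuous_on_subset by blast

lemma entire_compose:
  "f holomorphic_on UNIV \<Longrightarrow> h holomorphic_on UNIV \<Longrightarrow> (\<lambda>z. f (h z)) holomorphic_on UNIV"
  for f h :: "complex \<Rightarrow> complex"
  using holomorphic_on_compose_gen [of h UNIV f UNIV] by (simp add: o_def)

lemma entire_measurable:
  "f holomorphic_on UNIV \<Longrightarrow> f \<in> borel_measurable borel" for f :: "complex \<Rightarrow> complex"
  by (intro borel_measurable_continuous_onI entire_continuous_on)

lemma gauss_abs_measurable:
  "f holomorphic_on UNIV \<Longrightarrow> gauss_abs f \<in> borel_measurable borel"
  unfolding gauss_abs_def using entire_measurable by measurable

lemma gauss_abs_continuous_on:
  "f holomorphic_on UNIV \<Longrightarrow> continuous_on A (gauss_abs f)"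
  unfolding gauss_abs_def by (intro continuous_intros entire_continuous_on) auto

lemma ennreal_powr_le_cmult:
  assumes "0 \<le> a" "a \<le> c * b" "0 \<le> b" "0 < c" "0 < q" "ennreal (b powr q) \<le> R"
  shows "ennreal (a powr q) \<le> ennreal (c powr q) * R"
proof -
  have "a powr q \<le> (c * b) powr q" using assms by (intro powr_mono2) auto
  also have "\<dots> = c powr q * b powr q" using assms by (simp add: powr_mult)
  finally have "ennreal (a powr q) \<le> ennreal (c powr q) * ennreal (b powr q)"
    by (simp add: ennreal_leI flip: ennreal_mult)
  also have "\<dots> \<le> ennreal (c powr q) * R"
    using assms by (intro mult_left_mono) auto
  finally show ?thesis .
qed

text \<open>Multiplying by \<open>exp (- cnj x * \<zeta>)\<close> turns the Gaussian weight around \<open>x\<close> into the one around \<open>0\<close>,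
  which is bounded above and below on the unit disc.\<close>

lemma fock_local_bound:
  assumes q: "q > 0"
  obtains C where "C > 0"
    "\<And>f x. f holomorphic_on UNIV \<Longrightarrow> ennreal (gauss_abs f x powr q) \<le> ennreal C * local_mass q f x"
    "\<And>f x. f holomorphic_on UNIV \<Longrightarrow>
        ennreal ((gauss_abs (deriv f) x / (1 + norm x)) powr q) \<le> ennreal C * local_mass q f x"
proof -
  obtain C0 where C0: "C0 > 0" and loc:
    "\<And>F z. F holomorphic_on UNIV \<Longrightarrow> norm (z::complex) \<le> 1/2 \<Longrightarrow>
       ennreal (norm (F z) powr q) \<le> ennreal C0 * (\<integral>\<^sup>+ \<zeta>\<in>ball 0 1. ennreal (norm (F \<zeta>) powr q) \<partial>lborel)"
    using entire_local_power_bound [OF q] by blast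
  \<comment> \<open>One \<open>2 powr q\<close> bounds
    \<open>exp ((norm \<zeta>)\<^sup>2 / 2)\<close> on the unit disc; the other comes from Cauchy's
    inequality on the circle of radius \<open>1/2\<close>.\<close>
  define C where "C = 2 powr q * (C0 * 2 powr q)"
  have "C > 0" using C0 by (simp add: C_def)
  have key: "ennreal (gauss_abs f x powr q) \<le> ennreal C * local_mass q f x \<and>
     ennreal ((gauss_abs (deriv f) x / (1 + norm x)) powr q) \<le> ennreal C * local_mass q f x"
    if f: "f holomorphic_on UNIV" for f x
  proof -
    have [measurable]: "gauss_abs f \<in> borel_measurable borel" by (rule gauss_abs_measurable [OF f])
    define E where "E = complex_of_real (exp (- (norm x)\<^sup>2 / 2))"
    define F where "F = (\<lambda>\<zeta>. E * (f (x + \<zeta>) * exp (- (cnj x * \<zeta>))))"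
    have fd: "(f has_field_derivative deriv f z) (at z)" for z
      using f by (simp add: holomorphic_derivI)
    have shift_f: "(\<lambda>\<zeta>. f (x + \<zeta>)) holomorphic_on UNIV"
      by (rule entire_compose [OF f]) (intro holomorphic_intros)
    have F: "F holomorphic_on UNIV"
      unfolding F_def by (intro holomorphic_intros shift_f)
    have nF: "norm (F \<zeta>) = gauss_abs f (x + \<zeta>) * exp ((norm \<zeta>)\<^sup>2 / 2)" for \<zeta>
    proof -
      have "(norm (x + \<zeta>))\<^sup>2 = (norm x)\<^sup>2 + 2 * Re (cnj x * \<zeta>) + (norm \<zeta>)\<^sup>2"
        unfolding cmod_power2 by (simp add: power2_eq_square algebra_simps)
      then have "exp (- (norm x)\<^sup>2 / 2) * exp (- Re (cnj x * \<zeta>)) =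
            exp (- (norm (x + \<zeta>))\<^sup>2 / 2) * exp ((norm \<zeta>)\<^sup>2 / 2)"
        by (simp add: field_simps flip: exp_add)
      moreover have "norm (F \<zeta>) = norm (f (x + \<zeta>)) * (exp (- (norm x)\<^sup>2 / 2) * exp (- Re (cnj x * \<zeta>)))"
        by (simp add: F_def E_def norm_mult)
      ultimately show ?thesis by (simp add: gauss_abs_def)
    qed
    let ?J = "\<integral>\<^sup>+ \<zeta>\<in>ball 0 1. ennreal (norm (F \<zeta>) powr q) \<partial>lborel"
    have J: "?J \<le> ennreal (2 powr q) * local_mass q f x"
    proof -
      have "?J \<le> (\<integral>\<^sup>+ \<zeta>. ennreal (2 powr q) *
               (ennreal (gauss_abs f (x + \<zeta>) powr q) * indicator (ball x 1) (x + \<zeta>)) \<partial>lborel)"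
      proof (intro nn_integral_mono)
        fix \<zeta> :: complex
        have "ennreal (norm (F \<zeta>) powr q) \<le> ennreal (2 powr q) * ennreal (gauss_abs f (x + \<zeta>) powr q)"
          if "norm \<zeta> < 1"
        proof (rule ennreal_powr_le_cmult)
          have "exp ((norm \<zeta>)\<^sup>2 / 2) \<le> exp (1/2)"
            using that by (simp add: power_le_one)
          also have "\<dots> \<le> 2"
            using exp_half_le2 by simp
          finally have "gauss_abs f (x + \<zeta>) * exp ((norm \<zeta>)\<^sup>2 / 2) \<le> gauss_abs f (x + \<zeta>) * 2"
            by (intro mult_left_mono) auto
          then show "norm (F \<zeta>) \<le> 2 * gauss_abs f (x + \<zeta>)"
            unfolding nF by linarith
        qed (use q in auto)
        then show "ennreal (norm (F \<zeta>) powr q) * indicator (ball 0 1) \<zeta> \<le>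
          ennreal (2 powr q) * (ennreal (gauss_abs f (x + \<zeta>) powr q) * indicator (ball x 1) (x + \<zeta>))"
          by (auto simp: indicator_def dist_norm)
      qed
      also have "\<dots> = (\<integral>\<^sup>+ v. ennreal (2 powr q) *
               (ennreal (gauss_abs f v powr q) * indicator (ball x 1) v) \<partial>lborel)"
        by (rule nn_integral_lborel_shift
             [where f = "\<lambda>v. ennreal (2 powr q) * (ennreal (gauss_abs f v powr q) * indicator (ball x 1) v)"])
           measurable
      also have "\<dots> = ennreal (2 powr q) * local_mass q f x"
        unfolding local_mass_def by (rule nn_integral_cmult) measurable
      finally show ?thesis .
    qed
    \<comment> \<open>The maximum over the half disc controls both \<open>F 0\<close> and, by
      Cauchy's inequality, \<open>deriv F 0\<close>, so one application of the local power bound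
      serves both claims.\<close>
    obtain \<zeta>0 where z0: "norm \<zeta>0 \<le> 1/2" and max: "\<And>\<zeta>. norm \<zeta> \<le> 1/2 \<Longrightarrow> norm (F \<zeta>) \<le> norm (F \<zeta>0)"
    proof -
      have "continuous_on (cball 0 (1/2)) (\<lambda>\<zeta>. norm (F \<zeta>))"
        by (intro continuous_intros entire_continuous_on F)
      then show ?thesis
        using continuous_attains_sup [of "cball 0 (1/2)" "\<lambda>\<zeta>. norm (F \<zeta>)"] that by auto
    qed
    have "ennreal (norm (F \<zeta>0) powr q) \<le> ennreal C0 * ?J"
      by (rule loc [OF F z0])
    also have "\<dots> \<le> ennreal C0 * (ennreal (2 powr q) * local_mass q f x)"
      by (intro mult_left_mono J) auto
    finally have B: "ennreal (norm (F \<zeta>0) powr q) \<le> ennreal (C0 * 2 powr q) * local_mass q f x"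
      using C0 by (simp add: ennreal_mult mult.assoc)
    have Ceq: "ennreal C * local_mass q f x = ennreal (2 powr q) * (ennreal (C0 * 2 powr q) * local_mass q f x)"
      using C0 unfolding C_def by (simp add: ennreal_mult mult.assoc)
    have F0: "gauss_abs f x \<le> norm (F \<zeta>0)"
      using max [of 0] by (simp add: nF)
    then have F0': "gauss_abs f x \<le> 2 * norm (F \<zeta>0)"
      using norm_ge_zero [of "F \<zeta>0"] by linarith
    \<comment> \<open>The exponential factor of \<open>F\<close> contributes the term with
      \<open>cnj x\<close>. Removing it costs \<open>norm x\<close> times the bound for
      \<open>f\<close>, whence the division by \<open>1 + norm x\<close>.\<close>
    have dF: "deriv F 0 = E * (deriv f x - cnj x * f x)"
      unfolding F_def
      by (rule DERIV_imp_deriv) (auto intro!: derivative_eq_intros DERIV_chain2 [OF fd] simp: algebra_simps)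
    have "norm ((deriv ^^ 1) F 0) \<le> fact 1 * norm (F \<zeta>0) / (1/2)^1"
      by (rule Cauchy_inequality)
         (use F max in \<open>auto intro: entire_continuous_on holomorphic_on_subset\<close>)
    then have d0: "norm (deriv F 0) \<le> 2 * norm (F \<zeta>0)" by simp
    have "E * deriv f x = deriv F 0 + cnj x * (E * f x)"
      unfolding dF by (simp add: algebra_simps)
    then have "norm (E * deriv f x) \<le> norm (deriv F 0) + norm x * norm (E * f x)"
      by (metis norm_triangle_ineq norm_mult complex_mod_cnj)
    moreover have "norm (E * deriv f x) = gauss_abs (deriv f) x" "norm (E * f x) = gauss_abs f x"
      by (auto simp: E_def gauss_abs_def norm_mult)
    ultimately have "gauss_abs (deriv f) x \<le> 2 * norm (F \<zeta>0) + norm x * norm (F \<zeta>0)"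
      using d0 mult_left_mono [OF F0, of "norm x"] by simp
    also have "\<dots> \<le> 2 * norm (F \<zeta>0) * (1 + norm x)"
      by (simp add: algebra_simps)
    finally have "gauss_abs (deriv f) x / (1 + norm x) \<le> 2 * norm (F \<zeta>0)"
      by (simp add: pos_divide_le_eq)
    then show ?thesis
      unfolding Ceq using F0' q
      by (intro conjI ennreal_powr_le_cmult [OF _ _ _ _ _ B]) (auto simp: add_nonneg_nonneg)
  qed
  show ?thesis using that [OF \<open>C > 0\<close>] key by blast
qed

subsection \<open>Recovering a function from its derivative\<close>

text \<open>The first hypothesis encodes that \<open>w\<close> lies on the segment from 0 to
  \<open>z\<close>. At distance \<open>d\<close> along it, the squared norm drops by at least
  \<open>d\<^sup>2\<close>, while \<open>norm (z - v) \<le> d + 1\<close> and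
  \<open>(d + 1)\<^sup>2 \<le> 2 * d\<^sup>2 + 2\<close>. The additive 2 becomes the factor
  \<open>exp (q / 4)\<close>.\<close>

lemma gauss_weight_ball_le:
  fixes z v w :: complex
  assumes "norm (z - w) = norm z - norm w" "dist w v < 1" "q > 0"
  shows "exp (- (q / 4) * ((norm z)\<^sup>2 - (norm w)\<^sup>2)) \<le> exp (q / 4) * exp (- (q / 8) * (norm (z - v))\<^sup>2)"
proof -
  define d where "d = norm (z - w)"
  have d: "d \<ge> 0" "norm z = norm w + d" using assms(1) norm_ge_zero [of "z - w"] unfolding d_def by linarith+
  have "norm (z - v) \<le> d + 1"
    using norm_triangle_ineq [of "z - w" "w - v"] assms by (simp add: d_def dist_norm)
  then have "(norm (z - v))\<^sup>2 \<le> (d + 1)\<^sup>2" by (intro power_mono) auto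
  also have "\<dots> \<le> 2 * d\<^sup>2 + 2"
    using sum_squares_ge_zero [of "d - 1" 0] by (simp add: power2_eq_square algebra_simps)
  finally have 1: "(norm (z - v))\<^sup>2 \<le> 2 * d\<^sup>2 + 2" .
  have "(norm z)\<^sup>2 - (norm w)\<^sup>2 = d\<^sup>2 + 2 * d * norm w"
    unfolding d by (simp add: power2_eq_square algebra_simps)
  then have "d\<^sup>2 \<le> (norm z)\<^sup>2 - (norm w)\<^sup>2" using d by simp
  with 1 have "(norm (z - v))\<^sup>2 - 2 \<le> 2 * ((norm z)\<^sup>2 - (norm w)\<^sup>2)" by simp
  then have "q / 8 * ((norm (z - v))\<^sup>2 - 2) \<le> q / 8 * (2 * ((norm z)\<^sup>2 - (norm w)\<^sup>2))"
    using assms by (intro mult_left_mono) auto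
  then show ?thesis by (simp add: algebra_simps flip: exp_add)
qed

text \<open>Integration of the derivative along the segment uses only half of the Gaussian gain
  between \<open>t * z\<close> and \<open>z\<close>. The other half stays inside \<open>S\<close>,
  where it later provides decay in the distance from \<open>z\<close>.\<close>

lemma entire_radial_growth:
  fixes F :: "complex \<Rightarrow> complex" and S :: real
  assumes F: "F holomorphic_on UNIV" and F0: "F 0 = 0"
    and S: "\<And>t. t \<in> {0..1} \<Longrightarrow>
       gauss_abs (deriv F) (of_real t * z) / (1 + norm (of_real t * z))
         * exp (- ((norm z)\<^sup>2 - (norm (of_real t * z))\<^sup>2) / 4) \<le> S"
  shows "gauss_abs F z \<le> 8 * S"
proof -
  define r where "r = norm z"
  have r: "r \<ge> 0" by (simp add: r_def)
  have S0: "S \<ge> 0"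
    by (rule order_trans [OF _ S [of 1]]) (auto simp: add_nonneg_nonneg)
  have fd: "(F has_field_derivative deriv F w) (at w)" for w
    using F by (simp add: holomorphic_derivI)
  have vd: "((\<lambda>t. F (of_real t * z)) has_vector_derivative (deriv F (of_real t * z) * z)) (at t)" for t :: real
  proof -
    have "((\<lambda>s. F (s * z)) has_field_derivative (deriv F (of_real t * z) * z)) (at (of_real t))"
      by (auto intro!: derivative_eq_intros DERIV_chain2 [OF fd])
    then show ?thesis by (rule has_vector_derivative_real_field)
  qed
  have dF: "norm (deriv F (of_real t * z) * z) \<le> r * (1 + r) * S * exp ((1 + t) * r\<^sup>2 / 4)"
    if t: "t \<in> {0..1}" for t :: real
  proof -
    have nt: "norm (of_real t * z) = t * r" using t by (simp add: norm_mult r_def)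
    have "norm (deriv F (of_real t * z)) =
       (gauss_abs (deriv F) (of_real t * z) / (1 + t * r) * exp (- (r\<^sup>2 - (t * r)\<^sup>2) / 4))
        * (1 + t * r) * (exp ((t * r)\<^sup>2 / 2) * exp ((r\<^sup>2 - (t * r)\<^sup>2) / 4))"
    proof -
      define X where "X = r\<^sup>2 - (t * r)\<^sup>2"
      have "norm (deriv F (of_real t * z)) = gauss_abs (deriv F) (of_real t * z) * exp ((t * r)\<^sup>2 / 2)"
        unfolding gauss_abs_def nt by (simp add: mult.assoc flip: exp_add)
      moreover have "exp (- X / 4) * exp (X / 4) = 1" by (simp flip: exp_add)
      moreover have "1 + t * r \<noteq> 0" using t r by (simp add: add_nonneg_eq_0_iff)
      ultimately show ?thesis unfolding X_def [symmetric] by (simp add: mult_ac)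
    qed
    also have "\<dots> \<le> S * (1 + r) * exp ((1 + t) * r\<^sup>2 / 4)"
    proof (intro mult_mono)
      show "gauss_abs (deriv F) (of_real t * z) / (1 + t * r) * exp (- (r\<^sup>2 - (t * r)\<^sup>2) / 4) \<le> S"
        using S [OF t] unfolding nt by (simp add: r_def)
      show "1 + t * r \<le> 1 + r" using t r by (simp add: mult_left_le_one_le)
      \<comment> \<open>Making the exponent linear in \<open>t\<close> gives a majorant with an
        explicit primitive.\<close>
      have "t\<^sup>2 * r\<^sup>2 \<le> t * r\<^sup>2"
        using t by (intro mult_right_mono) (auto simp: power2_eq_square mult_left_le_one_le)
      then show "exp ((t * r)\<^sup>2 / 2) * exp ((r\<^sup>2 - (t * r)\<^sup>2) / 4) \<le> exp ((1 + t) * r\<^sup>2 / 4)"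
        by (simp add: field_simps power_mult_distrib flip: exp_add)
    qed (use S0 r t in auto)
    finally have "r * norm (deriv F (of_real t * z)) \<le> r * (S * (1 + r) * exp ((1 + t) * r\<^sup>2 / 4))"
      using r by (intro mult_left_mono)
    then show ?thesis by (simp add: norm_mult r_def mult_ac)
  qed
  have cont: "continuous_on {0..1} (\<lambda>t::real. F (of_real t * z))"
    using vd by (intro continuous_at_imp_continuous_on)
      (auto intro: has_vector_derivative_continuous)
  \<comment> \<open>The primitive of the majorant contains \<open>(1 + r) / r\<close>, which is at
    most 2 for \<open>r \<ge> 1\<close> but unbounded near 0. For small \<open>r\<close> the
    majorant is replaced by a constant.\<close>
  have "norm (F z) \<le> 8 * S * exp (r\<^sup>2 / 2)"
  proof (cases "r \<ge> 1")
    case True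
    define \<Phi> where "\<Phi> = (\<lambda>t. (1 + r) * S * 4 / r * exp ((1 + t) * r\<^sup>2 / 4))"
    have "norm (F (of_real 1 * z) - F (of_real 0 * z)) \<le> \<Phi> 1 - \<Phi> 0"
    proof (rule differentiable_bound_general)
      show "(\<Phi> has_vector_derivative r * (1 + r) * S * exp ((1 + t) * r\<^sup>2 / 4)) (at t)" for t
        unfolding \<Phi>_def has_real_derivative_iff_has_vector_derivative [symmetric] using True
        by (auto intro!: derivative_eq_intros simp: field_simps power2_eq_square)
      show "continuous_on {0..1} \<Phi>" unfolding \<Phi>_def by (intro continuous_intros) auto
    qed (use vd dF cont in auto)
    also have "\<dots> \<le> \<Phi> 1" using r S0 by (simp add: \<Phi>_def)
    also have "\<dots> = (4 * ((1 + r) / r)) * S * exp (r\<^sup>2 / 2)" by (simp add: \<Phi>_def)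
    also have "\<dots> \<le> 8 * S * exp (r\<^sup>2 / 2)"
      using True S0 by (intro mult_right_mono) (auto simp: field_simps)
    finally show ?thesis by (simp add: F0)
  next
    case False
    define \<Phi> where "\<Phi> = (\<lambda>t::real. 2 * S * exp (r\<^sup>2 / 2) * t)"
    have "norm (F (of_real 1 * z) - F (of_real 0 * z)) \<le> \<Phi> 1 - \<Phi> 0"
    proof (rule differentiable_bound_general)
      show "(\<Phi> has_vector_derivative 2 * S * exp (r\<^sup>2 / 2)) (at t)" for t
        unfolding \<Phi>_def has_real_derivative_iff_has_vector_derivative [symmetric]
        by (auto intro!: derivative_eq_intros)
      show "continuous_on {0..1} \<Phi>" unfolding \<Phi>_def by (intro continuous_intros) auto
      fix t :: real assume t: "0 < t" "t < 1"
      have "r * (1 + r) * S * exp ((1 + t) * r\<^sup>2 / 4) \<le> 2 * S * exp (r\<^sup>2 / 2)"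
      proof (intro mult_mono)
        show "r * (1 + r) \<le> 2" using False r mult_mono [of r 1 "1 + r" 2] by simp
        have "(1 + t) * r\<^sup>2 \<le> 2 * r\<^sup>2" using t by (intro mult_right_mono) auto
        then show "exp ((1 + t) * r\<^sup>2 / 4) \<le> exp (r\<^sup>2 / 2)" by simp
      qed (use S0 r in auto)
      with dF [of t] t show "norm (deriv F (of_real t * z) * z) \<le> 2 * S * exp (r\<^sup>2 / 2)" by simp
    qed (use vd cont in auto)
    then have "norm (F z) \<le> 2 * (S * exp (r\<^sup>2 / 2))" by (simp add: F0 \<Phi>_def)
    also have "\<dots> \<le> 8 * (S * exp (r\<^sup>2 / 2))" using S0 by (intro mult_right_mono) auto
    finally show ?thesis by simp
  qed
  then have "norm (F z) * exp (- r\<^sup>2 / 2) \<le> 8 * S * exp (r\<^sup>2 / 2) * exp (- r\<^sup>2 / 2)"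
    by (intro mult_right_mono) auto
  then show ?thesis by (simp add: gauss_abs_def r_def mult.assoc flip: exp_add)
qed

text \<open>The factor \<open>gauss_abs (deriv F) v / (1 + norm v)\<close> at a point of the segment \<open>[0, z]\<close> is
  controlled by its local mean, and the Gaussian loss along the segment dominates the distance to \<open>z\<close>.
  This works for every exponent \<open>q > 0\<close>.\<close>

lemma fock_derivative_bound:
  assumes q: "q > 0"
  obtains C where "C > 0"
    "\<And>F. F holomorphic_on UNIV \<Longrightarrow> F 0 = 0 \<Longrightarrow>
      (\<integral>\<^sup>+ z. ennreal (gauss_abs F z powr q) \<partial>lborel)
        \<le> ennreal C * (\<integral>\<^sup>+ v. ennreal ((gauss_abs (deriv F) v / (1 + norm v)) powr q) \<partial>lborel)"
proof -
  obtain C0 where C0: "C0 > 0" and loc: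
    "\<And>f x. f holomorphic_on UNIV \<Longrightarrow> ennreal (gauss_abs f x powr q) \<le> ennreal C0 * local_mass q f x"
    using fock_local_bound [OF q] by metis
  define A where "A = (\<integral>\<^sup>+ z. ennreal (exp (- (q/8) * (norm (z::complex))\<^sup>2)) \<partial>lborel)"
  have A: "A < \<infinity>" unfolding A_def using q by (intro nn_integral_gaussian_complex_finite) auto
  define C1 where "C1 = 8 powr q * (C0 * 2 powr q * exp (q / 4))"
  have C1: "C1 > 0" using C0 by (simp add: C1_def)
  \<comment> \<open>The summand 1 makes \<open>C\<close> positive without a lower bound for
    \<open>A\<close>.\<close>
  define C where "C = C1 * enn2real A + 1"
  have C: "C > 0" "ennreal C1 * A \<le> ennreal C"
  proof -
    show "C > 0" using C1 by (simp add: C_def add_nonneg_pos)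
    have "ennreal C1 * A = ennreal (C1 * enn2real A)"
      using A C1 by (simp add: ennreal_mult)
    then show "ennreal C1 * A \<le> ennreal C"
      using C1 by (simp add: C_def ennreal_leI)
  qed
  have main: "(\<integral>\<^sup>+ z. ennreal (gauss_abs F z powr q) \<partial>lborel)
        \<le> ennreal C * (\<integral>\<^sup>+ v. ennreal ((gauss_abs (deriv F) v / (1 + norm v)) powr q) \<partial>lborel)"
    if F: "F holomorphic_on UNIV" and F0: "F 0 = 0" for F
  proof -
    have F': "deriv F holomorphic_on UNIV" using F by (intro holomorphic_deriv) auto
    define N where "N = (\<lambda>v. gauss_abs (deriv F) v / (1 + norm v))"
    have [measurable]: "gauss_abs (deriv F) \<in> borel_measurable borel" by (rule gauss_abs_measurable [OF F'])
    have mN [measurable]: "N \<in> borel_measurable borel" unfolding N_def by measurable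
    have N0: "N v \<ge> 0" for v by (simp add: N_def add_nonneg_nonneg)
    \<comment> \<open>Across a unit disc \<open>1 + norm v\<close> changes by a factor of at most 2,
      so the local bound survives division by it.\<close>
    have locN: "ennreal (N w powr q) \<le> ennreal (C0 * 2 powr q) *
        (\<integral>\<^sup>+ v\<in>ball w 1. ennreal (N v powr q) \<partial>lborel)" for w
    proof -
      define c where "c = 1 / (1 + norm w)"
      have c: "c > 0" unfolding c_def by (intro divide_pos_pos add_pos_nonneg) auto
      have "ennreal (N w powr q) \<le> ennreal (c powr q) * (ennreal C0 * local_mass q (deriv F) w)"
        by (rule ennreal_powr_le_cmult [OF _ _ _ _ _ loc [OF F']])
           (use c q in \<open>auto simp: N0 N_def c_def\<close>)
      also have "\<dots> = ennreal C0 * (ennreal (c powr q) * local_mass q (deriv F) w)"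
        by (simp add: mult_ac)
      also have "ennreal (c powr q) * local_mass q (deriv F) w =
         (\<integral>\<^sup>+ v. ennreal (c powr q) * (ennreal (gauss_abs (deriv F) v powr q) * indicator (ball w 1) v) \<partial>lborel)"
        unfolding local_mass_def by (rule nn_integral_cmult [symmetric]) measurable
      also have "\<dots> \<le> (\<integral>\<^sup>+ v. ennreal (2 powr q) * (ennreal (N v powr q) * indicator (ball w 1) v) \<partial>lborel)"
      proof (intro nn_integral_mono)
        fix v
        have "ennreal (c powr q) * ennreal (gauss_abs (deriv F) v powr q) \<le> ennreal (2 powr q) * ennreal (N v powr q)"
          if "dist w v < 1"
        proof -
          have "norm v \<le> norm w + 1"
            using that norm_triangle_sub [of v w] by (simp add: dist_norm norm_minus_commute)
          then have "1 + norm v \<le> 2 * (1 + norm w)"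
            using norm_ge_zero [of w] by argo
          then have "c * (1 + norm v) \<le> 2"
            unfolding c_def by (simp add: pos_divide_le_eq)
          then have "c * (1 + norm v) * N v \<le> 2 * N v"
            by (intro mult_right_mono N0)
          moreover have "(1 + norm v) * N v = gauss_abs (deriv F) v" by (simp add: N_def)
          ultimately have "c * gauss_abs (deriv F) v \<le> 2 * N v" by (simp add: mult.assoc)
          then have "(c * gauss_abs (deriv F) v) powr q \<le> (2 * N v) powr q"
            using c q by (intro powr_mono2) auto
          then show ?thesis
            using c N0 by (simp add: powr_mult ennreal_leI flip: ennreal_mult)
        qed
        then show "ennreal (c powr q) * (ennreal (gauss_abs (deriv F) v powr q) * indicator (ball w 1) v)
           \<le> ennreal (2 powr q) * (ennreal (N v powr q) * indicator (ball w 1) v)"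
          by (auto simp: indicator_def)
      qed
      also have "\<dots> = ennreal (2 powr q) * (\<integral>\<^sup>+ v\<in>ball w 1. ennreal (N v powr q) \<partial>lborel)"
        by (rule nn_integral_cmult) measurable
      finally show ?thesis using C0 by (simp add: ennreal_mult mult_left_mono mult.assoc)
    qed
    have pt: "ennreal (gauss_abs F z powr q) \<le> ennreal C1 *
        (\<integral>\<^sup>+ v. ennreal (exp (- (q/8) * (norm (z - v))\<^sup>2)) * ennreal (N v powr q) \<partial>lborel)"
      (is "_ \<le> _ * ?R") for z
    proof -
      \<comment> \<open>The supremum \<open>S\<close> of \<open>entire_radial_growth\<close> is
        attained at some \<open>t0\<close>. Raising this single value to the power \<open>q\<close>
        is harmless also for \<open>q < 1\<close>, and it is then spread over a unit disc.\<close>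
      define \<phi> where "\<phi> = (\<lambda>t::real. N (of_real t * z) * exp (- ((norm z)\<^sup>2 - (norm (of_real t * z))\<^sup>2) / 4))"
      have "continuous_on {0..1} \<phi>"
        unfolding \<phi>_def N_def gauss_abs_def
        using norm_ge_zero [where 'a=complex]
        by (intro continuous_intros continuous_on_compose2 [OF entire_continuous_on [OF F', of UNIV]])
           (auto simp: add_nonneg_eq_0_iff)
      then obtain t0 where t0: "t0 \<in> {0..1}" and max: "\<And>t. t \<in> {0..1} \<Longrightarrow> \<phi> t \<le> \<phi> t0"
        using continuous_attains_sup [of "{0..1::real}" \<phi>] by auto
      have G: "gauss_abs F z \<le> 8 * \<phi> t0"
        by (rule entire_radial_growth [OF F F0]) (use max in \<open>simp add: \<phi>_def N_def\<close>)
      define w where "w = of_real t0 * z"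
      have nw: "norm (z - w) = norm z - norm w"
      proof -
        have "z - w = of_real (1 - t0) * z" by (simp add: w_def algebra_simps)
        then have "norm (z - w) = (1 - t0) * norm z" using t0 by (simp add: norm_mult del: of_real_diff)
        then show ?thesis using t0 by (simp add: w_def norm_mult algebra_simps)
      qed
      define e where "e = exp (- (q / 4) * ((norm z)\<^sup>2 - (norm w)\<^sup>2))"
      have "\<phi> t0 powr q = e * N w powr q"
        unfolding \<phi>_def w_def [symmetric] e_def using N0
        by (simp add: powr_mult exp_powr_real field_simps)
      then have "ennreal (\<phi> t0 powr q) = ennreal e * ennreal (N w powr q)"
        by (simp add: e_def ennreal_mult)
      also have "\<dots> \<le> ennreal e * (ennreal (C0 * 2 powr q) * (\<integral>\<^sup>+ v\<in>ball w 1. ennreal (N v powr q) \<partial>lborel))"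
        by (intro mult_left_mono locN) auto
      also have "\<dots> = ennreal (C0 * 2 powr q) *
           (\<integral>\<^sup>+ v. ennreal e * (ennreal (N v powr q) * indicator (ball w 1) v) \<partial>lborel)"
        by (subst nn_integral_cmult) (measurable, simp add: mult_ac)
      also have "\<dots> \<le> ennreal (C0 * 2 powr q) *
           (\<integral>\<^sup>+ v. ennreal (exp (q/4)) * (ennreal (exp (- (q/8) * (norm (z - v))\<^sup>2)) * ennreal (N v powr q)) \<partial>lborel)"
      proof (intro mult_left_mono nn_integral_mono)
        fix v
        have "ennreal e \<le> ennreal (exp (q/4)) * ennreal (exp (- (q/8) * (norm (z - v))\<^sup>2))" if "dist w v < 1"
          using gauss_weight_ball_le [OF nw that q]
          by (simp add: e_def ennreal_leI flip: ennreal_mult)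
        then have "ennreal e * indicator (ball w 1) v \<le> ennreal (exp (q/4)) * ennreal (exp (- (q/8) * (norm (z - v))\<^sup>2))"
          by (auto simp: indicator_def)
        then have "ennreal e * indicator (ball w 1) v * ennreal (N v powr q)
           \<le> ennreal (exp (q/4)) * ennreal (exp (- (q/8) * (norm (z - v))\<^sup>2)) * ennreal (N v powr q)"
          by (rule mult_right_mono) auto
        then show "ennreal e * (ennreal (N v powr q) * indicator (ball w 1) v) \<le>
           ennreal (exp (q/4)) * (ennreal (exp (- (q/8) * (norm (z - v))\<^sup>2)) * ennreal (N v powr q))"
          by (simp only: mult_ac)
      qed auto
      also have "\<dots> = ennreal (C0 * 2 powr q) * (ennreal (exp (q/4)) * ?R)"
        by (subst nn_integral_cmult) auto
      also have "\<dots> = ennreal (C0 * 2 powr q * exp (q/4)) * ?R"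
        using C0 by (simp add: ennreal_mult mult.assoc)
      finally have "ennreal (\<phi> t0 powr q) \<le> ennreal (C0 * 2 powr q * exp (q/4)) * ?R" .
      then have "ennreal (gauss_abs F z powr q) \<le> ennreal (8 powr q) * (ennreal (C0 * 2 powr q * exp (q/4)) * ?R)"
        using G q N0 by (intro ennreal_powr_le_cmult) (auto simp: \<phi>_def)
      then show ?thesis
        using C0 by (simp add: C1_def ennreal_mult mult.assoc)
    qed
    have "(\<integral>\<^sup>+ z. ennreal (gauss_abs F z powr q) \<partial>lborel) \<le> (\<integral>\<^sup>+ z. ennreal C1 *
        (\<integral>\<^sup>+ v. ennreal (exp (- (q/8) * (norm (z - v))\<^sup>2)) * ennreal (N v powr q) \<partial>lborel) \<partial>lborel)"
      by (intro nn_integral_mono pt)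
    also have "\<dots> = ennreal C1 * (\<integral>\<^sup>+ z.
        (\<integral>\<^sup>+ v. ennreal (exp (- (q/8) * (norm (z - v))\<^sup>2)) * ennreal (N v powr q) \<partial>lborel) \<partial>lborel)"
      by (rule nn_integral_cmult) measurable
    also have "\<dots> \<le> ennreal C1 * (A * (\<integral>\<^sup>+ v. ennreal (N v powr q) \<partial>lborel))"
    proof (intro mult_left_mono nn_integral_schur)
      fix v :: complex
      have "(\<integral>\<^sup>+ z. ennreal (exp (- (q/8) * (norm (z - v))\<^sup>2)) \<partial>lborel) = A"
        using nn_integral_lborel_shift [of "\<lambda>z. ennreal (exp (- (q/8) * (norm (z::complex))\<^sup>2))" "- v"]
        by (simp add: A_def)
      then show "(\<integral>\<^sup>+ z. ennreal (exp (- (q/8) * (norm (z - v))\<^sup>2)) \<partial>lborel) \<le> A" by simp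
    qed auto
    also have "\<dots> \<le> ennreal C * (\<integral>\<^sup>+ v. ennreal (N v powr q) \<partial>lborel)"
      using mult_right_mono [OF C(2)] by (simp add: mult.assoc)
    finally show ?thesis by (simp only: N_def)
  qed
  show ?thesis using that [OF C(1) main] by blast
qed

subsection \<open>Composition symbols of Gaussian growth are affine\<close>

lemma entire_divided_difference:
  fixes f :: "complex \<Rightarrow> complex"
  assumes "f holomorphic_on UNIV"
  obtains h where "h holomorphic_on UNIV" "\<And>z. f z = f a + (z - a) * h z"
proof
  show "(\<lambda>z. if z = a then deriv f a else (f z - f a) / (z - a)) holomorphic_on UNIV"
    using assms by (intro pole_lemma_open) auto
qed auto

lemma entire_affine_if_deriv2_zero:
  fixes f :: "complex \<Rightarrow> complex"
  assumes f: "f holomorphic_on UNIV" and z: "\<And>z. deriv (deriv f) z = 0"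
  shows "\<exists>a b. \<forall>z. f z = a * z + b"
proof -
  have f': "deriv f holomorphic_on UNIV" using f by (intro holomorphic_deriv) auto
  have "\<exists>a. \<forall>w\<in>UNIV. deriv f w = a"
    using holomorphic_derivI [OF f'] z
    by (intro has_field_derivative_zero_constant) auto
  then obtain a where a: "\<And>w. deriv f w = a" by auto
  have "((\<lambda>w. f w - a * w) has_field_derivative 0) (at w)" for w
    using holomorphic_derivI [OF f, of w] a by (auto intro!: derivative_eq_intros)
  then have "\<exists>b. \<forall>w\<in>UNIV. f w - a * w = b"
    by (intro has_field_derivative_zero_constant) auto
  then show ?thesis by (metis UNIV_I add.commute diff_add_cancel)
qed

text \<open>If \<open>\<psi>\<close> had a nonzero second Taylor coefficient \<open>a\<close> at a point \<open>z0\<close> with \<open>u z0 \<noteq> 0\<close>, then on the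
  circle of radius \<open>r\<close> about \<open>z0\<close> the function \<open>\<bar>\<psi>\<bar>\<^sup>2\<close> would dominate the real part of an entire function
  \<open>H\<close> with \<open>H z0 = \<bar>a\<bar>\<^sup>2 r\<^sup>4\<close>; the maximum principle for \<open>u * exp (H / 2)\<close> makes this too large.\<close>

lemma entire_affine_if_gaussian_growth:
  fixes u \<psi> :: "complex \<Rightarrow> complex"
  assumes u: "u holomorphic_on UNIV" and \<psi>: "\<psi> holomorphic_on UNIV" and nz: "u z1 \<noteq> 0"
    and bd: "\<And>z. norm (u z) * exp ((norm (\<psi> z))\<^sup>2 / 2) \<le> K * (1 + norm z) * exp ((norm z)\<^sup>2 / 2)"
  shows "\<exists>a b. \<forall>z. \<psi> z = a * z + b"
proof (rule ccontr)
  assume contr: "\<not> ?thesis"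
  have \<psi>': "deriv \<psi> holomorphic_on UNIV" using \<psi> by (intro holomorphic_deriv) auto
  have \<psi>'': "deriv (deriv \<psi>) holomorphic_on UNIV" by (rule holomorphic_deriv [OF \<psi>']) simp
  obtain z2 where z2: "deriv (deriv \<psi>) z2 \<noteq> 0"
    using contr entire_affine_if_deriv2_zero [OF \<psi>] by blast
  \<comment> \<open>Otherwise the second derivative would vanish on the nonempty open set where
    \<open>u\<close> is nonzero, hence everywhere.\<close>
  obtain z0 where z0: "u z0 \<noteq> 0" "deriv (deriv \<psi>) z0 \<noteq> 0"
  proof (rule ccontr)
    assume no: "\<not> thesis"
    have "open {z. u z \<noteq> 0}"
      using entire_continuous_on [OF u] by (intro open_Collect_neq) auto
    then have "deriv (deriv \<psi>) z2 = 0"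
      using analytic_continuation_open [of "{z. u z \<noteq> 0}" UNIV "deriv (deriv \<psi>)" "\<lambda>z. 0" z2]
        \<psi>'' no that nz by auto
    with z2 show False by simp
  qed
  \<comment> \<open>Two divided differences write the second-order Taylor remainder as
    \<open>(z - z0)\<^sup>2 * \<phi> z\<close> with \<open>\<phi>\<close> entire;
    \<open>2 * \<phi> z0\<close> is the second derivative of \<open>\<psi>\<close> at
    \<open>z0\<close>.\<close>
  obtain h where h: "h holomorphic_on UNIV" "\<And>z. \<psi> z = \<psi> z0 + (z - z0) * h z"
    using entire_divided_difference [OF \<psi>, of z0] by blast
  obtain \<phi> where \<phi>: "\<phi> holomorphic_on UNIV" "\<And>z. h z = h z0 + (z - z0) * \<phi> z"
    using entire_divided_difference [OF h(1), of z0] by blast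
  define a where "a = \<phi> z0"
  define c0 where "c0 = \<psi> z0"
  define c1 where "c1 = h z0"
  have \<psi>_eq: "\<psi> z = c0 + c1 * (z - z0) + (z - z0)\<^sup>2 * \<phi> z" for z
    using h(2) [of z] \<phi>(2) [of z] by (simp add: c0_def c1_def power2_eq_square algebra_simps)
  have "a \<noteq> 0"
  proof -
    have \<phi>': "deriv \<phi> holomorphic_on UNIV" using \<phi> by (intro holomorphic_deriv) auto
    have d\<phi>: "(\<phi> has_field_derivative deriv \<phi> z) (at z)" for z
      using \<phi> by (simp add: holomorphic_derivI)
    have d\<phi>': "(deriv \<phi> has_field_derivative deriv (deriv \<phi>) z) (at z)" for z
      using \<phi>' by (simp add: holomorphic_derivI)
    have "deriv \<psi> = (\<lambda>z. c1 + 2 * (z - z0) * \<phi> z + (z - z0)\<^sup>2 * deriv \<phi> z)"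
    proof
      fix z
      have "((\<lambda>z. c0 + c1 * (z - z0) + (z - z0)\<^sup>2 * \<phi> z) has_field_derivative
          c1 + 2 * (z - z0) * \<phi> z + (z - z0)\<^sup>2 * deriv \<phi> z) (at z)"
        by (auto intro!: derivative_eq_intros d\<phi>)
      then show "deriv \<psi> z = c1 + 2 * (z - z0) * \<phi> z + (z - z0)\<^sup>2 * deriv \<phi> z"
        by (intro DERIV_imp_deriv) (simp add: \<psi>_eq [abs_def])
    qed
    moreover have "((\<lambda>z. c1 + 2 * (z - z0) * \<phi> z + (z - z0)\<^sup>2 * deriv \<phi> z) has_field_derivative 2 * \<phi> z0) (at z0)"
      by (auto intro!: derivative_eq_intros d\<phi> d\<phi>')
    ultimately have "deriv (deriv \<psi>) z0 = 2 * a"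
      by (simp add: DERIV_imp_deriv a_def)
    with z0 show ?thesis by simp
  qed
  define c where "c = norm z0"
  have K: "K > 0"
  proof (rule ccontr)
    assume "\<not> K > 0"
    then have "K * (1 + norm z0) * exp ((norm z0)\<^sup>2 / 2) \<le> 0"
      by (intro mult_nonpos_nonneg) auto
    moreover have "norm (u z0) * exp ((norm (\<psi> z0))\<^sup>2 / 2) > 0" using z0 by simp
    ultimately show False using bd [of z0] by linarith
  qed
  have growth: "norm (u z0) * exp ((norm a)\<^sup>2 * r ^ 4 / 2) \<le> K * (1 + r + c) * exp ((r + c)\<^sup>2 / 2)"
    if r: "r > 0" for r :: real
  proof -
    \<comment> \<open>With \<open>\<zeta> = z - z0\<close> and
      \<open>w = a * \<zeta>\<^sup>2\<close>, the square of \<open>norm (\<psi> z - w)\<close> being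
      nonnegative bounds the squared norm of \<open>\<psi> z\<close> below by
      \<open>2 * Re (\<psi> z * cnj w)\<close> minus the squared norm of \<open>w\<close>. On the
      circle \<open>\<zeta> * cnj \<zeta> = r\<^sup>2\<close>; using this, and conjugating the terms
      with \<open>c0\<close> and \<open>c1\<close>, makes the bound the real part of an entire
      function.\<close>
    define H where "H = (\<lambda>z. 2 * (cnj c0 * a * (z - z0)\<^sup>2 + cnj c1 * a * (z - z0) * of_real (r\<^sup>2)
        + \<phi> z * cnj a * of_real (r ^ 4)) - of_real ((norm a)\<^sup>2 * r ^ 4))"
    have H0: "H z0 = of_real ((norm a)\<^sup>2 * r ^ 4)"
      unfolding H_def a_def [symmetric] by (simp add: complex_norm_square [symmetric] del: of_real_power)
    have ReH: "Re (H z) \<le> (norm (\<psi> z))\<^sup>2" if z: "norm (z - z0) = r" for z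
    proof -
      define \<zeta> where "\<zeta> = z - z0"
      have rr: "\<zeta> * cnj \<zeta> = of_real (r\<^sup>2)"
        using complex_norm_square [of \<zeta>] z by (simp add: \<zeta>_def)
      define w where "w = a * \<zeta>\<^sup>2"
      have "c0 * cnj w = cnj (cnj c0 * a * \<zeta>\<^sup>2)" by (simp add: w_def)
      then have 1: "Re (c0 * cnj w) = Re (cnj c0 * a * \<zeta>\<^sup>2)" by (simp only: cnj.simps)
      have "c1 * \<zeta> * cnj w = c1 * cnj a * (\<zeta> * cnj \<zeta>) * cnj \<zeta>"
        by (simp add: w_def power2_eq_square)
      also have "\<dots> = cnj (cnj c1 * a * \<zeta> * of_real (r\<^sup>2))" unfolding rr by simp
      finally have 2: "Re (c1 * \<zeta> * cnj w) = Re (cnj c1 * a * \<zeta> * of_real (r\<^sup>2))" by (simp only: cnj.simps)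
      have "\<zeta>\<^sup>2 * \<phi> z * cnj w = \<phi> z * cnj a * (\<zeta> * cnj \<zeta>)\<^sup>2"
        by (simp add: w_def power2_eq_square)
      also have "\<dots> = \<phi> z * cnj a * of_real (r ^ 4)" unfolding rr by (simp flip: power_mult)
      finally have 3: "\<zeta>\<^sup>2 * \<phi> z * cnj w = \<phi> z * cnj a * of_real (r ^ 4)" .
      have "(norm w)\<^sup>2 = (norm a)\<^sup>2 * r ^ 4"
        using z by (simp add: w_def \<zeta>_def norm_mult norm_power power_mult_distrib flip: power_mult)
      moreover have "0 \<le> (norm (\<psi> z - w))\<^sup>2" by simp
      moreover have "(norm (\<psi> z - w))\<^sup>2 = (norm (\<psi> z))\<^sup>2 - 2 * Re (\<psi> z * cnj w) + (norm w)\<^sup>2"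
        unfolding cmod_power2 by (simp add: power2_eq_square algebra_simps)
      moreover have "Re (\<psi> z * cnj w) = Re (c0 * cnj w) + Re (c1 * \<zeta> * cnj w) + Re (\<zeta>\<^sup>2 * \<phi> z * cnj w)"
        by (simp only: \<psi>_eq \<zeta>_def [symmetric] distrib_right plus_complex.sel)
      moreover have "Re (H z) = 2 * (Re (cnj c0 * a * \<zeta>\<^sup>2) + Re (cnj c1 * a * \<zeta> * of_real (r\<^sup>2))
            + Re (\<phi> z * cnj a * of_real (r ^ 4))) - (norm a)\<^sup>2 * r ^ 4"
        by (simp add: H_def \<zeta>_def)
      ultimately show ?thesis unfolding 1 2 3 by argo
    qed
    have "norm (u z0 * exp (H z0 / 2)) \<le> K * (1 + r + c) * exp ((r + c)\<^sup>2 / 2)"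
    proof (rule maximum_modulus_frontier [of "\<lambda>z. u z * exp (H z / 2)" "cball z0 r"])
      have hol: "(\<lambda>z. u z * exp (H z / 2)) holomorphic_on UNIV"
        unfolding H_def by (intro holomorphic_intros u \<phi>) auto
      then show "(\<lambda>z. u z * exp (H z / 2)) holomorphic_on interior (cball z0 r)"
        using holomorphic_on_subset by blast
      show "continuous_on (closure (cball z0 r)) (\<lambda>z. u z * exp (H z / 2))"
        by (rule entire_continuous_on [OF hol])
      fix z assume "z \<in> frontier (cball z0 r)"
      then have z: "norm (z - z0) = r"
        using r by (auto simp: dist_norm norm_minus_commute)
      have nzr: "norm z \<le> r + c"
        using norm_triangle_sub [of z z0] z by (simp add: c_def)
      have "norm (u z * exp (H z / 2)) = norm (u z) * exp (Re (H z) / 2)"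
        by (simp add: norm_mult)
      also have "\<dots> \<le> norm (u z) * exp ((norm (\<psi> z))\<^sup>2 / 2)"
        using ReH [OF z] by (intro mult_left_mono) auto
      also have "\<dots> \<le> K * (1 + norm z) * exp ((norm z)\<^sup>2 / 2)" by (rule bd)
      also have "\<dots> \<le> K * (1 + r + c) * exp ((r + c)\<^sup>2 / 2)"
        using nzr K r by (intro mult_mono) (auto simp: c_def power_mono add_nonneg_nonneg)
      finally show "norm (u z * exp (H z / 2)) \<le> K * (1 + r + c) * exp ((r + c)\<^sup>2 / 2)" .
    qed (use r in auto)
    then show ?thesis by (simp add: norm_mult H0)
  qed
  \<comment> \<open>The left side of \<open>growth\<close> has a quartic exponent in
    \<open>r\<close>, the right side a quadratic one, so it fails for large
    \<open>r\<close>.\<close>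
  define A where "A = (norm a)\<^sup>2"
  define B where "B = norm (u z0)"
  have "A > 0" "B > 0" using \<open>a \<noteq> 0\<close> z0 by (auto simp: A_def B_def)
  then have "((\<lambda>r. K * (1 + r + c) * exp ((r + c)\<^sup>2 / 2) / (B * exp (A * r ^ 4 / 2))) \<longlongrightarrow> 0) at_top"
    using K by real_asymp
  then have "eventually (\<lambda>r. K * (1 + r + c) * exp ((r + c)\<^sup>2 / 2) / (B * exp (A * r ^ 4 / 2)) < 1) at_top"
    by (rule order_tendstoD) simp
  then have "eventually (\<lambda>r. K * (1 + r + c) * exp ((r + c)\<^sup>2 / 2) / (B * exp (A * r ^ 4 / 2)) < 1 \<and> r > 0) at_top"
    using eventually_gt_at_top [of 0] by eventually_elim auto
  then obtain r where r: "K * (1 + r + c) * exp ((r + c)\<^sup>2 / 2) / (B * exp (A * r ^ 4 / 2)) < 1" "r > 0"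
    using eventually_happens [of _ "at_top :: real filter"] by force
  then have "K * (1 + r + c) * exp ((r + c)\<^sup>2 / 2) < B * exp (A * r ^ 4 / 2)"
    using \<open>B > 0\<close> by (simp add: divide_less_eq)
  with growth [OF r(2)] show False by (simp add: A_def B_def)
qed

subsection \<open>Fock norms\<close>

text \<open>The normalising factor of \<open>fock_integral\<close> is dropped and the value stays in
  \<open>ennreal\<close>, so estimates can be chained before finiteness is known.\<close>

definition fock_mass :: "real \<Rightarrow> (complex \<Rightarrow> complex) \<Rightarrow> ennreal" where
  "fock_mass p f = (\<integral>\<^sup>+ z. ennreal (gauss_abs f z powr p) \<partial>lborel)"

lemma fock_integral_eq_mass: "fock_integral p f = ennreal (p / (2 * pi)) * fock_mass p f"
proof -
  have "norm (f z) powr p * exp (- (p / 2) * (norm z)\<^sup>2) = gauss_abs f z powr p" for z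
    by (simp add: gauss_abs_def powr_mult exp_powr_real algebra_simps)
  then show ?thesis by (simp add: fock_integral_def fock_mass_def)
qed

lemma fock_norm_nonneg [simp]: "fock_norm p f \<ge> 0"
  by (simp add: fock_norm_def)

text \<open>\<open>fock_norm\<close> passes through \<open>enn2real\<close>, which sends infinity to
  0. Membership excludes that case, so the passage can be inverted.\<close>

lemma fock_mass_eq_norm:
  assumes p: "p > 0" and f: "in_fock p f"
  shows "fock_mass p f = ennreal (2 * pi / p * fock_norm p f powr p)"
proof -
  have fin: "ennreal (p / (2 * pi)) * fock_mass p f < \<infinity>"
    using f by (simp add: in_fock_def fock_integral_eq_mass)
  have "fock_mass p f \<noteq> \<infinity>"
    using fin p by (auto simp: ennreal_mult_top)
  then obtain m where m: "m \<ge> 0" "fock_mass p f = ennreal m"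
    by (cases "fock_mass p f") auto
  have "fock_norm p f = (p / (2 * pi) * m) powr (1 / p)"
    using m p by (simp add: fock_norm_def fock_integral_eq_mass flip: ennreal_mult)
  then have "fock_norm p f powr p = p / (2 * pi) * m"
    using m p by (simp add: powr_powr)
  then show ?thesis using m p by simp
qed

lemma in_fock_if_mass_le:
  assumes p: "p > 0" and f: "f holomorphic_on UNIV" and B: "B \<ge> 0"
    and le: "fock_mass p f \<le> ennreal (2 * pi / p * B powr p)"
  shows "in_fock p f" "fock_norm p f \<le> B"
proof -
  have "fock_integral p f \<le> ennreal (p / (2 * pi)) * ennreal (2 * pi / p * B powr p)"
    unfolding fock_integral_eq_mass by (intro mult_left_mono le) auto
  also have "\<dots> = ennreal (B powr p)"
    using p by (simp flip: ennreal_mult)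
  finally have I: "fock_integral p f \<le> ennreal (B powr p)" .
  then show "in_fock p f"
    using f by (auto simp: in_fock_def intro: le_less_trans)
  have "enn2real (fock_integral p f) \<le> B powr p"
    using I by (simp add: enn2real_leI)
  then have "fock_norm p f \<le> (B powr p) powr (1 / p)"
    unfolding fock_norm_def using p by (intro powr_mono2) auto
  then show "fock_norm p f \<le> B" using p B by (simp add: powr_powr)
qed

lemma local_mass_le_fock_mass: "local_mass s f x \<le> fock_mass s f"
  unfolding local_mass_def fock_mass_def
  by (intro nn_integral_mono) (auto simp: indicator_def)

lemma local_mass_le_sup:
  assumes s: "s > 0" and e: "e \<ge> 0" and le: "\<And>v. v \<in> ball x 1 \<Longrightarrow> norm (f v) \<le> e"
  shows "local_mass s f x \<le> ennreal (e powr s * pi)"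
proof -
  have "local_mass s f x \<le> (\<integral>\<^sup>+ v. ennreal (e powr s) * indicator (ball x 1) v \<partial>lborel)"
    unfolding local_mass_def
  proof (intro nn_integral_mono)
    fix v
    have "gauss_abs f v \<le> e" if "v \<in> ball x 1"
    proof -
      have "gauss_abs f v \<le> norm (f v) * 1" unfolding gauss_abs_def by (intro mult_left_mono) auto
      with le [OF that] show ?thesis by simp
    qed
    then show "ennreal (gauss_abs f v powr s) * indicator (ball x 1) v
        \<le> ennreal (e powr s) * indicator (ball x 1) v"
      using s by (auto simp: indicator_def intro!: ennreal_leI powr_mono2)
  qed
  also have "\<dots> = ennreal (e powr s * pi)"
    by (simp add: nn_integral_cmult_indicator emeasure_ball unit_ball_vol_2 ennreal_mult)
  finally show ?thesis .
qed

lemma le_fock_norm_if_local: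
  assumes s: "s > 0" and C: "C > 0" and f: "in_fock s f" and a: "a \<ge> 0"
    and le: "ennreal (a powr s) \<le> ennreal C * local_mass s f x"
  shows "a \<le> (C * (2 * pi / s)) powr (1 / s) * fock_norm s f"
proof -
  have "ennreal (a powr s) \<le> ennreal C * fock_mass s f"
    by (rule order_trans [OF le mult_left_mono [OF local_mass_le_fock_mass]]) simp
  also have "\<dots> = ennreal (C * (2 * pi / s * fock_norm s f powr s))"
    using C s by (simp add: fock_mass_eq_norm [OF s f] flip: ennreal_mult)
  finally have le': "a powr s \<le> C * (2 * pi / s * fock_norm s f powr s)"
    using C s by (subst (asm) ennreal_le_iff) auto
  define k where "k = C * (2 * pi / s)"
  have k: "k > 0" using C s by (simp add: k_def)
  have "(a powr s) powr (1 / s) \<le> (k * fock_norm s f powr s) powr (1 / s)"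
    using s le' by (intro powr_mono2) (auto simp: k_def mult.assoc)
  then show ?thesis
    unfolding k_def [symmetric] using s k a by (simp add: powr_powr powr_mult)
qed

lemma fock_pointwise:
  assumes s: "s > 0"
  obtains K where "K > 0"
    "\<And>f x. in_fock s f \<Longrightarrow> gauss_abs f x \<le> K * fock_norm s f"
    "\<And>f x. in_fock s f \<Longrightarrow> gauss_abs (deriv f) x / (1 + norm x) \<le> K * fock_norm s f"
proof -
  obtain C where C: "C > 0"
    "\<And>f x. f holomorphic_on UNIV \<Longrightarrow> ennreal (gauss_abs f x powr s) \<le> ennreal C * local_mass s f x"
    "\<And>f x. f holomorphic_on UNIV \<Longrightarrow>
        ennreal ((gauss_abs (deriv f) x / (1 + norm x)) powr s) \<le> ennreal C * local_mass s f x"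
    using fock_local_bound [OF s] by metis
  show ?thesis
  proof
    show "(C * (2 * pi / s)) powr (1 / s) > 0" using C s by simp
    show "gauss_abs f x \<le> (C * (2 * pi / s)) powr (1 / s) * fock_norm s f" if "in_fock s f" for f x
      using that C(2) by (intro le_fock_norm_if_local [OF s C(1) that]) (auto simp: in_fock_def)
    show "gauss_abs (deriv f) x / (1 + norm x) \<le> (C * (2 * pi / s)) powr (1 / s) * fock_norm s f"
      if "in_fock s f" for f x
      using that C(3) by (intro le_fock_norm_if_local [OF s C(1) that]) (auto simp: in_fock_def)
  qed
qed

text \<open>Split the \<open>q\<close>-th power into the powers \<open>q - p\<close> and
  \<open>p\<close> and apply the pointwise bound to the first. This is where
  \<open>p \<le> q\<close> carries weight.\<close>

lemma fock_embedding:
  assumes p: "0 < p" and pq: "p \<le> q"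
  obtains C where "C > 0" "\<And>f. in_fock p f \<Longrightarrow> fock_mass q f \<le> ennreal (C * fock_norm p f powr q)"
proof -
  obtain K where K: "K > 0" "\<And>f x. in_fock p f \<Longrightarrow> gauss_abs f x \<le> K * fock_norm p f"
    using fock_pointwise [OF p] by metis
  show ?thesis
  proof
    show "K powr (q - p) * (2 * pi / p) > 0" using K p by simp
    fix f assume f: "in_fock p f"
    let ?n = "fock_norm p f"
    have [measurable]: "gauss_abs f \<in> borel_measurable borel"
      using f by (intro gauss_abs_measurable) (simp add: in_fock_def)
    have "fock_mass q f \<le> (\<integral>\<^sup>+ z. ennreal ((K * ?n) powr (q - p)) * ennreal (gauss_abs f z powr p) \<partial>lborel)"
      unfolding fock_mass_def
    proof (intro nn_integral_mono)
      fix z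
      have "gauss_abs f z powr q = gauss_abs f z powr (q - p) * gauss_abs f z powr p"
        by (simp flip: powr_add)
      also have "\<dots> \<le> (K * ?n) powr (q - p) * gauss_abs f z powr p"
        using pq K(2) [OF f] by (intro mult_right_mono powr_mono2) auto
      finally show "ennreal (gauss_abs f z powr q)
          \<le> ennreal ((K * ?n) powr (q - p)) * ennreal (gauss_abs f z powr p)"
        by (simp add: ennreal_leI flip: ennreal_mult)
    qed
    also have "\<dots> = ennreal ((K * ?n) powr (q - p)) * fock_mass p f"
      unfolding fock_mass_def by (rule nn_integral_cmult) measurable
    also have "\<dots> = ennreal ((K * ?n) powr (q - p) * (2 * pi / p * ?n powr p))"
      using p by (simp add: fock_mass_eq_norm [OF p f] flip: ennreal_mult)
    also have "(K * ?n) powr (q - p) * (2 * pi / p * ?n powr p)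
        = K powr (q - p) * (2 * pi / p) * (?n powr (q - p) * ?n powr p)"
      using K by (simp add: powr_mult)
    also have "?n powr (q - p) * ?n powr p = ?n powr q"
      by (simp flip: powr_add)
    finally show "fock_mass q f \<le> ennreal (K powr (q - p) * (2 * pi / p) * ?n powr q)" .
  qed
qed

text \<open>Bounding a sum by twice the maximum gives a quasi-triangle inequality valid for all
  \<open>s > 0\<close>, whereas subadditivity of the norm would require
  \<open>s \<ge> 1\<close>.\<close>

lemma fock_mass_diff_le:
  assumes s: "s > 0" and f: "f holomorphic_on UNIV" and h: "h holomorphic_on UNIV"
  shows "fock_mass s (\<lambda>z. f z - h z) \<le> ennreal (2 powr s) * (fock_mass s f + fock_mass s h)"
proof -
  have [measurable]: "gauss_abs f \<in> borel_measurable borel" "gauss_abs h \<in> borel_measurable borel"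
    using f h by (auto intro: gauss_abs_measurable)
  have "fock_mass s (\<lambda>z. f z - h z) \<le>
     (\<integral>\<^sup>+ z. ennreal (2 powr s) * (ennreal (gauss_abs f z powr s) + ennreal (gauss_abs h z powr s)) \<partial>lborel)"
    unfolding fock_mass_def
  proof (intro nn_integral_mono ennreal_powr_le_cmult)
    fix z
    have "gauss_abs (\<lambda>z. f z - h z) z \<le> gauss_abs f z + gauss_abs h z"
      unfolding gauss_abs_def distrib_right [symmetric]
      by (intro mult_right_mono norm_triangle_ineq4) auto
    also have "\<dots> \<le> 2 * max (gauss_abs f z) (gauss_abs h z)" by simp
    finally show "gauss_abs (\<lambda>z. f z - h z) z \<le> 2 * max (gauss_abs f z) (gauss_abs h z)" .
    show "ennreal (max (gauss_abs f z) (gauss_abs h z) powr s)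
        \<le> ennreal (gauss_abs f z powr s) + ennreal (gauss_abs h z powr s)"
      by (simp add: max_def ennreal_leI flip: ennreal_plus)
  qed (use s in \<open>auto simp: le_max_iff_disj\<close>)
  also have "\<dots> = ennreal (2 powr s) * (fock_mass s f + fock_mass s h)"
    unfolding fock_mass_def by (subst nn_integral_cmult) (auto simp: nn_integral_add)
  finally show ?thesis .
qed

lemma fock_diff:
  assumes s: "s > 0" and f: "in_fock s f" and h: "in_fock s h"
  shows "in_fock s (\<lambda>z. f z - h z)"
    and "fock_norm s (\<lambda>z. f z - h z) \<le> 2 * (fock_norm s f powr s + fock_norm s h powr s) powr (1 / s)"
proof -
  let ?B = "2 * (fock_norm s f powr s + fock_norm s h powr s) powr (1 / s)"
  have fh: "f holomorphic_on UNIV" "h holomorphic_on UNIV" using f h by (auto simp: in_fock_def)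
  have "fock_mass s (\<lambda>z. f z - h z) \<le> ennreal (2 powr s) * (fock_mass s f + fock_mass s h)"
    by (rule fock_mass_diff_le [OF s fh])
  also have "\<dots> = ennreal (2 powr s * (2 * pi / s * fock_norm s f powr s + 2 * pi / s * fock_norm s h powr s))"
    using s by (simp add: fock_mass_eq_norm [OF s f] fock_mass_eq_norm [OF s h] flip: ennreal_plus ennreal_mult)
  also have "2 powr s * (2 * pi / s * fock_norm s f powr s + 2 * pi / s * fock_norm s h powr s) = 2 * pi / s * ?B powr s"
    using s by (simp add: powr_mult powr_powr add_nonneg_nonneg algebra_simps)
  finally have le: "fock_mass s (\<lambda>z. f z - h z) \<le> ennreal (2 * pi / s * ?B powr s)" .
  have hol: "(\<lambda>z. f z - h z) holomorphic_on UNIV" by (intro holomorphic_intros fh)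
  show "in_fock s (\<lambda>z. f z - h z)" "fock_norm s (\<lambda>z. f z - h z) \<le> ?B"
    by (rule in_fock_if_mass_le [OF s hol _ le]; simp)+
qed

text \<open>The unit discs about \<open>z n\<close> eventually miss any fixed point, so their masses
  tend to 0 by dominated convergence, and these masses control the weighted derivative.\<close>

lemma fock_deriv_vanishes_at_infinity:
  assumes s: "s > 0" and h: "in_fock s h" and z: "filterlim z at_infinity sequentially"
  shows "(\<lambda>n. gauss_abs (deriv h) (z n) / (1 + norm (z n))) \<longlonglongrightarrow> 0"
proof -
  have hol: "h holomorphic_on UNIV" using h by (simp add: in_fock_def)
  have [measurable]: "gauss_abs h \<in> borel_measurable borel" by (rule gauss_abs_measurable [OF hol])
  obtain C where C: "C > 0"
    "\<And>f x. f holomorphic_on UNIV \<Longrightarrow>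
        ennreal ((gauss_abs (deriv f) x / (1 + norm x)) powr s) \<le> ennreal C * local_mass s f x"
    using fock_local_bound [OF s] by metis
  have "(\<lambda>n. local_mass s h (z n)) \<longlonglongrightarrow> (\<integral>\<^sup>+ v. (0::ennreal) \<partial>(lborel :: complex measure))"
    unfolding local_mass_def
  proof (rule nn_integral_dominated_convergence)
    show "(\<integral>\<^sup>+ v. ennreal (gauss_abs h v powr s) \<partial>lborel) < \<infinity>"
      using fock_mass_eq_norm [OF s h] by (simp add: fock_mass_def)
    show "AE v in lborel. (\<lambda>n. ennreal (gauss_abs h v powr s) * indicator (ball (z n) 1) v) \<longlonglongrightarrow> 0"
    proof (rule AE_I2)
      fix v :: complex
      have "eventually (\<lambda>n. norm v + 1 \<le> norm (z n)) sequentially"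
      proof -
        have "\<forall>r>0. eventually (\<lambda>n. r \<le> norm (z n)) sequentially"
          using z by (simp add: filterlim_at_infinity [of 0])
        moreover have "norm v + 1 > 0" by (simp add: add_nonneg_pos)
        ultimately show ?thesis by blast
      qed
      then have "eventually (\<lambda>n. ennreal (gauss_abs h v powr s) * indicator (ball (z n) 1) v = 0) sequentially"
      proof eventually_elim
        case (elim n)
        then have "1 \<le> dist (z n) v"
          using norm_triangle_ineq2 [of "z n" v] by (simp add: dist_norm)
        then show ?case by (simp add: indicator_def)
      qed
      then show "(\<lambda>n. ennreal (gauss_abs h v powr s) * indicator (ball (z n) 1) v) \<longlonglongrightarrow> 0"
        by (rule tendsto_eventually)
    qed
  qed (auto simp: indicator_def)
  then have up: "(\<lambda>n. ennreal C * local_mass s h (z n)) \<longlonglongrightarrow> ennreal C * 0"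
    by (intro ennreal_tendsto_cmult) (auto simp: C)
  have "(\<lambda>n. ennreal ((gauss_abs (deriv h) (z n) / (1 + norm (z n))) powr s)) \<longlonglongrightarrow> 0"
  proof (rule tendsto_sandwich [where f = "\<lambda>_. 0"])
    show "eventually (\<lambda>n. ennreal ((gauss_abs (deriv h) (z n) / (1 + norm (z n))) powr s)
        \<le> ennreal C * local_mass s h (z n)) sequentially"
      using C(2) [OF hol] by simp
    show "(\<lambda>n. ennreal C * local_mass s h (z n)) \<longlonglongrightarrow> 0" using up by simp
    show "(\<lambda>n. 0 :: ennreal) \<longlonglongrightarrow> 0" by simp
  qed simp
  then have "(\<lambda>n. (gauss_abs (deriv h) (z n) / (1 + norm (z n))) powr s) \<longlonglongrightarrow> 0"
    by (simp add: ennreal_tendsto_0_iff)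
  then have "(\<lambda>n. ((gauss_abs (deriv h) (z n) / (1 + norm (z n))) powr s) powr (1 / s)) \<longlonglongrightarrow> 0"
    by (rule tendsto_zero_powrI [OF _ tendsto_const]) (use s in auto)
  then show ?thesis using s by (simp add: powr_powr)
qed

section \<open>Primitives, bounds for continuous symbols, and test functions\<close>

lemma contour_integral_entire:
  fixes k :: "complex \<Rightarrow> complex"
  assumes k: "k holomorphic_on UNIV"
  defines "F \<equiv> \<lambda>z. contour_integral (linepath 0 z) k"
  shows "(F has_field_derivative k z) (at z)" "F holomorphic_on UNIV" "deriv F z = k z" "F 0 = 0"
proof -
  obtain G where G: "\<And>x. (G has_field_derivative k x) (at x)"
    using holomorphic_convex_primitive' [OF convex_UNIV open_UNIV k] by auto
  have F: "F z = G z - G 0" for z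
    unfolding F_def
    by (rule contour_integral_unique)
       (use contour_integral_primitive [of UNIV G k "linepath 0 z"] G in auto)
  show d: "(F has_field_derivative k z) (at z)" for z
    using F [abs_def] G by (auto intro!: derivative_eq_intros)
  show "F holomorphic_on UNIV"
    using d by (auto simp: holomorphic_on_def field_differentiable_def)
  show "deriv F z = k z" by (rule DERIV_imp_deriv [OF d])
  show "F 0 = 0" by (simp add: F)
qed

text \<open>A strict violation at one point would persist on a ball, and balls have positive
  measure.\<close>

lemma AE_le_continuous_imp_le:
  fixes m :: "complex \<Rightarrow> real"
  assumes cont: "continuous_on UNIV m" and AE: "AE z in lborel. m z \<le> C"
  shows "m z \<le> C"
proof (rule ccontr)
  assume "\<not> m z \<le> C"
  then have "z \<in> {z. C < m z}" by simp
  moreover have "open {z. C < m z}" using cont by (intro open_Collect_less) auto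
  ultimately obtain e where e: "e > 0" "ball z e \<subseteq> {z. C < m z}" by (meson open_contains_ball)
  have "AE x in lborel. x \<notin> ball z e"
    using AE by eventually_elim (use e in force)
  then have "emeasure lborel (ball z e) = 0"
    by (subst (asm) AE_iff_measurable [of "ball z e"]) auto
  with e show False by (simp add: emeasure_ball unit_ball_vol_2)
qed

lemma ess_bounded_continuous_iff:
  assumes "continuous_on UNIV m" "\<And>z. m z \<ge> 0"
  shows "ess_bounded m \<longleftrightarrow> (\<exists>K. \<forall>z. m z \<le> K)"
proof
  assume "ess_bounded m"
  then obtain C where "AE z in lborel. m z \<le> C"
    using assms(2) by (auto simp: ess_bounded_def)
  then show "\<exists>K. \<forall>z. m z \<le> K" using AE_le_continuous_imp_le [OF assms(1)] by blast
next
  assume "\<exists>K. \<forall>z. m z \<le> K"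
  then show "ess_bounded m" using assms(2) by (auto simp: ess_bounded_def)
qed

lemma bounded_if_vanishes_at_infinity:
  fixes m :: "complex \<Rightarrow> real"
  assumes cont: "continuous_on UNIV m" and lim: "(m \<longlongrightarrow> 0) at_infinity"
  shows "\<exists>K. \<forall>z. m z \<le> K"
proof -
  have "eventually (\<lambda>z. m z < 1) at_infinity"
    using lim by (rule order_tendstoD) simp
  then obtain R where R: "\<And>z. R \<le> norm z \<Longrightarrow> m z < 1" by (auto simp: eventually_at_infinity)
  have "bounded (m ` cball 0 R)"
    using cont by (intro compact_imp_bounded compact_continuous_image) (auto intro: continuous_on_subset)
  then obtain B where B: "\<forall>z\<in>cball 0 R. norm (m z) \<le> B" by (auto simp: bounded_iff)
  have "m z \<le> max 1 B" for z
    using R [of z] bspec [OF B, of z] by (cases "R \<le> norm z") auto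
  then show ?thesis by blast
qed

text \<open>Under \<open>gauss_abs\<close> the kernel centred at \<open>w\<close> becomes a
  translate by \<open>w\<close> of one fixed Gaussian, hence a bound independent of
  \<open>w\<close>. The identity will be the test function for the derivative near 0.\<close>

lemma gaussian_in_fock:
  fixes p :: real
  assumes p: "p > 0"
  obtains B where "\<And>w. in_fock p (\<lambda>z. exp (cnj w * z - of_real ((norm w)\<^sup>2 / 2)))"
    "\<And>w. fock_norm p (\<lambda>z. exp (cnj w * z - of_real ((norm w)\<^sup>2 / 2))) \<le> B"
    "in_fock p (\<lambda>z. z)" "fock_norm p (\<lambda>z. z) \<le> B"
proof -
  \<comment> \<open>Half of the decay rate \<open>p / 2\<close> is given up to absorb the growth of
    the identity through \<open>norm z \<le> 2 * exp ((norm z)\<^sup>2 / 4)\<close>. One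
    \<open>B\<close> then serves the kernels and the identity.\<close>
  define A where "A = (\<integral>\<^sup>+ z. ennreal (exp (- (p / 4) * (norm (z::complex))\<^sup>2)) \<partial>lborel)"
  have "A < \<infinity>" unfolding A_def using p by (intro nn_integral_gaussian_complex_finite) auto
  then obtain \<alpha> where \<alpha>: "\<alpha> \<ge> 0" "A = ennreal \<alpha>" by (cases A) auto
  define B where "B = (2 powr p * \<alpha> * p / (2 * pi)) powr (1 / p)"
  have B: "B \<ge> 0" "ennreal (2 * pi / p * B powr p) = ennreal (2 powr p) * A"
    using p \<alpha> by (auto simp: B_def powr_powr simp flip: ennreal_mult)
  have k: "fock_mass p (\<lambda>z. exp (cnj w * z - of_real ((norm w)\<^sup>2 / 2))) \<le> ennreal (2 * pi / p * B powr p)" for w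
  proof -
    have "gauss_abs (\<lambda>z. exp (cnj w * z - of_real ((norm w)\<^sup>2 / 2))) z = exp (- (norm (- w + z))\<^sup>2 / 2)" for z
    proof -
      have "(norm (- w + z))\<^sup>2 = (norm z)\<^sup>2 - 2 * Re (cnj w * z) + (norm w)\<^sup>2"
        unfolding cmod_power2 by (simp add: power2_eq_square algebra_simps)
      then show ?thesis by (simp add: gauss_abs_def field_simps flip: exp_add)
    qed
    then have "fock_mass p (\<lambda>z. exp (cnj w * z - of_real ((norm w)\<^sup>2 / 2))) =
        (\<integral>\<^sup>+ z. ennreal (exp (- (norm (- w + z))\<^sup>2 / 2) powr p) \<partial>lborel)"
      by (simp add: fock_mass_def)
    also have "\<dots> = (\<integral>\<^sup>+ z. ennreal (exp (- (norm (z::complex))\<^sup>2 / 2) powr p) \<partial>lborel)"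
      by (rule nn_integral_lborel_shift) measurable
    also have "\<dots> \<le> (\<integral>\<^sup>+ z. ennreal (2 powr p) * ennreal (exp (- (p / 4) * (norm (z::complex))\<^sup>2)) \<partial>lborel)"
    proof (intro nn_integral_mono ennreal_powr_le_cmult)
      fix z :: complex
      have "exp (- (norm z)\<^sup>2 / 2) \<le> 1 * exp (- (norm z)\<^sup>2 / 4)" by simp
      also have "\<dots> \<le> 2 * exp (- (norm z)\<^sup>2 / 4)" by (intro mult_right_mono) auto
      finally show "exp (- (norm z)\<^sup>2 / 2) \<le> 2 * exp (- (norm z)\<^sup>2 / 4)" .
      show "ennreal (exp (- (norm z)\<^sup>2 / 4) powr p) \<le> ennreal (exp (- (p / 4) * (norm z)\<^sup>2))"
        by (simp add: exp_powr_real mult.commute)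
    qed (use p in auto)
    also have "\<dots> = ennreal (2 powr p) * A"
      unfolding A_def by (rule nn_integral_cmult) measurable
    finally show ?thesis by (simp only: B(2))
  qed
  have i: "fock_mass p (\<lambda>z. z) \<le> ennreal (2 * pi / p * B powr p)"
  proof -
    have "fock_mass p (\<lambda>z. z) \<le> (\<integral>\<^sup>+ z. ennreal (2 powr p) * ennreal (exp (- (p / 4) * (norm (z::complex))\<^sup>2)) \<partial>lborel)"
      unfolding fock_mass_def
    proof (intro nn_integral_mono ennreal_powr_le_cmult)
      fix z :: complex
      have "norm z \<le> 1 + (norm z)\<^sup>2 / 4"
        using zero_le_power2 [of "norm z / 2 - 1"] by (simp add: power2_eq_square algebra_simps)
      also have "\<dots> \<le> exp ((norm z)\<^sup>2 / 4)" by (rule exp_ge_add_one_self)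
      finally have "norm z \<le> 2 * exp ((norm z)\<^sup>2 / 4)"
        using exp_gt_zero [of "(norm z)\<^sup>2 / 4"] by linarith
      then have "norm z * exp (- (norm z)\<^sup>2 / 2) \<le> 2 * exp ((norm z)\<^sup>2 / 4) * exp (- (norm z)\<^sup>2 / 2)"
        by (intro mult_right_mono) auto
      also have "\<dots> = 2 * exp (- (norm z)\<^sup>2 / 4)"
        by (simp add: mult.assoc flip: exp_add)
      finally show "gauss_abs (\<lambda>z. z) z \<le> 2 * exp (- (norm z)\<^sup>2 / 4)"
        by (simp add: gauss_abs_def)
      show "ennreal (exp (- (norm z)\<^sup>2 / 4) powr p) \<le> ennreal (exp (- (p / 4) * (norm z)\<^sup>2))"
        by (simp add: exp_powr_real mult.commute)
    qed (use p in auto)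
    also have "\<dots> = ennreal (2 powr p) * A"
      unfolding A_def by (rule nn_integral_cmult) measurable
    finally show ?thesis by (simp only: B(2))
  qed
  show ?thesis
  proof
    fix w
    have hol: "(\<lambda>z. exp (cnj w * z - of_real ((norm w)\<^sup>2 / 2))) holomorphic_on UNIV"
      by (intro holomorphic_intros)
    show "in_fock p (\<lambda>z. exp (cnj w * z - of_real ((norm w)\<^sup>2 / 2)))"
      "fock_norm p (\<lambda>z. exp (cnj w * z - of_real ((norm w)\<^sup>2 / 2))) \<le> B"
      by (rule in_fock_if_mass_le [OF p hol B(1) k])+
    show "in_fock p (\<lambda>z. z)" "fock_norm p (\<lambda>z. z) \<le> B"
      by (rule in_fock_if_mass_le [OF p holomorphic_on_ident B(1) i])+
  qed
qed

lemma exists_small_powr: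
  fixes A \<delta> q :: real
  assumes "A \<ge> 0" "\<delta> > 0" "q > 0"
  obtains e where "e > 0" "A * e powr q \<le> \<delta>"
proof
  \<comment> \<open>Dividing by \<open>A + 1\<close> instead of \<open>A\<close> covers
    \<open>A = 0\<close>.\<close>
  show "(\<delta> / (A + 1)) powr (1 / q) > 0" using assms by simp
  have "A * (\<delta> / (A + 1)) \<le> \<delta>" using assms by (simp add: field_simps)
  then show "A * ((\<delta> / (A + 1)) powr (1 / q)) powr q \<le> \<delta>"
    using assms by (simp add: powr_powr)
qed

subsection \<open>Volterra-type operators\<close>

text \<open>\<open>V_op\<close> and \<open>J_op\<close> are the cases \<open>D f = f\<close>, \<open>\<omega> = 1\<close> and \<open>D f = deriv f\<close>, \<open>\<omega> x = 1 + norm x\<close>: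
  in both, \<open>\<omega>\<close> is the optimal pointwise growth of \<open>D f\<close> relative to that of \<open>f\<close>.\<close>

locale volterra_type =
  fixes p q :: real
    and D :: "(complex \<Rightarrow> complex) \<Rightarrow> complex \<Rightarrow> complex" and \<omega> :: "complex \<Rightarrow> real"
    and u \<psi> :: "complex \<Rightarrow> complex"
  assumes p: "0 < p" and pq: "p \<le> q"
    and u: "u holomorphic_on UNIV" and u_nonzero: "\<exists>z. u z \<noteq> 0"
    and \<psi>: "\<psi> holomorphic_on UNIV" and \<psi>_nonconst: "\<not> (\<exists>c. \<forall>z. \<psi> z = c)"
    and \<omega>_cont: "continuous_on UNIV \<omega>" and \<omega>_ge_1: "\<And>x. 1 \<le> \<omega> x"
    and D_holomorphic: "\<And>f. f holomorphic_on UNIV \<Longrightarrow> D f holomorphic_on UNIV"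
    and D_diff: "\<And>f h x. f holomorphic_on UNIV \<Longrightarrow> h holomorphic_on UNIV \<Longrightarrow>
        D (\<lambda>z. f z - h z) x = D f x - D h x"
    and D_local: "\<And>s. s > 0 \<Longrightarrow> \<exists>C>0. \<forall>f x. f holomorphic_on UNIV \<longrightarrow>
        ennreal ((gauss_abs (D f) x / \<omega> x) powr s) \<le> ennreal C * local_mass s f x"
    and D_test: "\<exists>B c. 0 < c \<and>
        (\<forall>w. \<exists>f. in_fock p f \<and> fock_norm p f \<le> B \<and> c * \<omega> w \<le> gauss_abs (D f) w)"
begin

definition T :: "(complex \<Rightarrow> complex) \<Rightarrow> complex \<Rightarrow> complex" where
  "T f z = contour_integral (linepath 0 z) (\<lambda>w. D f (\<psi> w) * u w)"

definition m :: "complex \<Rightarrow> real" where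
  "m z = norm (u z) * \<omega> (\<psi> z) / (1 + norm z) * exp (((norm (\<psi> z))\<^sup>2 - (norm z)\<^sup>2) / 2)"

text \<open>This factor is the size of \<open>D f\<close> at \<open>\<psi> v\<close> relative to its
  optimal growth. The quantity called \<open>N\<close> in the introductory text is the product
  \<open>N f v * m v\<close>.\<close>

definition N :: "(complex \<Rightarrow> complex) \<Rightarrow> complex \<Rightarrow> real" where
  "N f v = gauss_abs (D f) (\<psi> v) / \<omega> (\<psi> v)"

lemma q: "0 < q" using p pq by simp

lemma \<omega>_pos [simp]: "0 < \<omega> x" "0 \<le> \<omega> x" "\<omega> x \<noteq> 0"
  using \<omega>_ge_1 [of x] by auto

lemma m_nonneg [simp]: "0 \<le> m z"
  by (simp add: m_def)

lemma N_nonneg [simp]: "0 \<le> N f z"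
  by (simp add: N_def)

lemma m_cont: "continuous_on UNIV m"
  unfolding m_def
  by (intro continuous_intros entire_continuous_on u \<psi> continuous_on_compose2 [OF \<omega>_cont]) auto

lemma N_measurable:
  assumes "f holomorphic_on UNIV" shows "N f \<in> borel_measurable borel"
proof -
  have [measurable]: "gauss_abs (D f) \<in> borel_measurable borel"
    by (rule gauss_abs_measurable [OF D_holomorphic [OF assms]])
  have [measurable]: "\<psi> \<in> borel_measurable borel" by (rule entire_measurable [OF \<psi>])
  have [measurable]: "\<omega> \<in> borel_measurable borel" by (rule borel_measurable_continuous_onI [OF \<omega>_cont])
  show ?thesis unfolding N_def by measurable
qed

lemma T_primitive:
  assumes f: "f holomorphic_on UNIV"
  shows "T f holomorphic_on UNIV" "deriv (T f) z = D f (\<psi> z) * u z" "T f 0 = 0"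
    and "((T f) has_field_derivative D f (\<psi> z) * u z) (at z)"
proof -
  have k: "(\<lambda>w. D f (\<psi> w) * u w) holomorphic_on UNIV"
    by (intro holomorphic_intros u entire_compose [OF D_holomorphic [OF f] \<psi>])
  have T: "T f = (\<lambda>z. contour_integral (linepath 0 z) (\<lambda>w. D f (\<psi> w) * u w))"
    by (simp add: T_def [abs_def])
  show "T f holomorphic_on UNIV" "deriv (T f) z = D f (\<psi> z) * u z" "T f 0 = 0"
    "((T f) has_field_derivative D f (\<psi> z) * u z) (at z)"
    unfolding T using contour_integral_entire [OF k] by blast+
qed

text \<open>Both sides are primitives of the same function, by \<open>D_diff\<close>, and both
  vanish at 0.\<close>

lemma T_diff:
  assumes f: "f holomorphic_on UNIV" and h: "h holomorphic_on UNIV"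
  shows "T f z - T h z = T (\<lambda>z. f z - h z) z"
proof -
  have fh: "(\<lambda>z. f z - h z) holomorphic_on UNIV" by (intro holomorphic_intros f h)
  have "((\<lambda>z. T f z - T h z - T (\<lambda>z. f z - h z) z) has_field_derivative 0) (at z)" for z
    using T_primitive(4) [OF f] T_primitive(4) [OF h] T_primitive(4) [OF fh]
    by (auto intro!: derivative_eq_intros simp: D_diff [OF f h] algebra_simps)
  then have "\<exists>c. \<forall>z\<in>UNIV. T f z - T h z - T (\<lambda>z. f z - h z) z = c"
    by (intro has_field_derivative_zero_constant) auto
  then obtain c where c: "\<And>z. T f z - T h z - T (\<lambda>z. f z - h z) z = c" by blast
  from c [of 0] have "c = 0"
    by (simp add: T_primitive(3) [OF f] T_primitive(3) [OF h] T_primitive(3) [OF fh])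
  with c [of z] show ?thesis by simp
qed

text \<open>\<open>\<omega> (\<psi> v)\<close> and the Gaussian weight at \<open>\<psi> v\<close>
  cancel between the two factors. This identity dictates the form of the symbol
  \<open>m\<close>.\<close>

lemma deriv_T:
  assumes f: "f holomorphic_on UNIV"
  shows "gauss_abs (deriv (T f)) v / (1 + norm v) = N f v * m v"
proof -
  have "exp (- (norm (\<psi> v))\<^sup>2 / 2) * exp (((norm (\<psi> v))\<^sup>2 - (norm v)\<^sup>2) / 2) = exp (- (norm v)\<^sup>2 / 2)"
    by (simp add: field_simps flip: exp_add)
  moreover have "N f v * m v = norm (D f (\<psi> v)) * norm (u v) / (1 + norm v) *
     (exp (- (norm (\<psi> v))\<^sup>2 / 2) * exp (((norm (\<psi> v))\<^sup>2 - (norm v)\<^sup>2) / 2))"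
    by (simp add: N_def m_def gauss_abs_def)
  ultimately show ?thesis
    by (simp add: gauss_abs_def T_primitive(2) [OF f] norm_mult)
qed

lemma T_mass:
  obtains C where "C > 0" "\<And>f. f holomorphic_on UNIV \<Longrightarrow>
     fock_mass q (T f) \<le> ennreal C * (\<integral>\<^sup>+ v. ennreal ((N f v * m v) powr q) \<partial>lborel)"
proof -
  obtain C where C: "C > 0"
    "\<And>F. F holomorphic_on UNIV \<Longrightarrow> F 0 = 0 \<Longrightarrow>
      (\<integral>\<^sup>+ z. ennreal (gauss_abs F z powr q) \<partial>lborel)
        \<le> ennreal C * (\<integral>\<^sup>+ v. ennreal ((gauss_abs (deriv F) v / (1 + norm v)) powr q) \<partial>lborel)"
    using fock_derivative_bound [OF q] by blast
  show ?thesis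
  proof (rule that [OF C(1)])
    fix f :: "complex \<Rightarrow> complex" assume f: "f holomorphic_on UNIV"
    show "fock_mass q (T f) \<le> ennreal C * (\<integral>\<^sup>+ v. ennreal ((N f v * m v) powr q) \<partial>lborel)"
      using C(2) [OF T_primitive(1,3) [OF f]] by (simp only: fock_mass_def deriv_T [OF f])
  qed
qed

text \<open>As \<open>\<omega> \<ge> 1\<close>, the bound on \<open>m\<close> persists when
  \<open>\<omega>\<close> is dropped, which leaves the Gaussian growth condition.\<close>

lemma \<psi>_affine:
  assumes K: "\<And>z. m z \<le> K"
  obtains a b where "a \<noteq> 0" "\<And>z. \<psi> z = a * z + b"
proof -
  obtain z1 where z1: "u z1 \<noteq> 0" using u_nonzero by blast
  have "norm (u z) * exp ((norm (\<psi> z))\<^sup>2 / 2) \<le> K * (1 + norm z) * exp ((norm z)\<^sup>2 / 2)" for z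
  proof -
    have "exp ((norm (\<psi> z))\<^sup>2 / 2) = exp (((norm (\<psi> z))\<^sup>2 - (norm z)\<^sup>2) / 2) * exp ((norm z)\<^sup>2 / 2)"
      by (simp add: field_simps flip: exp_add)
    then have "norm (u z) * exp ((norm (\<psi> z))\<^sup>2 / 2)
       = norm (u z) * 1 * (exp (((norm (\<psi> z))\<^sup>2 - (norm z)\<^sup>2) / 2) * exp ((norm z)\<^sup>2 / 2))"
      by simp
    also have "\<dots> \<le> norm (u z) * \<omega> (\<psi> z) * (exp (((norm (\<psi> z))\<^sup>2 - (norm z)\<^sup>2) / 2) * exp ((norm z)\<^sup>2 / 2))"
      by (intro mult_right_mono mult_left_mono \<omega>_ge_1) auto
    also have "\<dots> = m z * (1 + norm z) * exp ((norm z)\<^sup>2 / 2)"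
      by (simp add: m_def)
    also have "\<dots> \<le> K * (1 + norm z) * exp ((norm z)\<^sup>2 / 2)"
      by (intro mult_right_mono K) auto
    finally show ?thesis .
  qed
  then obtain a b where ab: "\<And>z. \<psi> z = a * z + b"
    using entire_affine_if_gaussian_growth [OF u \<psi> z1] by blast
  moreover have "a \<noteq> 0" using ab \<psi>_nonconst by auto
  ultimately show ?thesis using that by blast
qed

lemma N_integral:
  assumes K: "\<And>z. m z \<le> K"
  obtains C where "C > 0" "\<And>f. f holomorphic_on UNIV \<Longrightarrow>
     (\<integral>\<^sup>+ v. ennreal (N f v powr q) \<partial>lborel) \<le> ennreal C * fock_mass q f"
proof -
  obtain a b where a: "a \<noteq> 0" and ab: "\<And>z. \<psi> z = a * z + b" using \<psi>_affine [OF K] by blast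
  obtain C0 where C0: "C0 > 0" and loc: "\<And>f x. f holomorphic_on UNIV \<Longrightarrow>
      ennreal ((gauss_abs (D f) x / \<omega> x) powr q) \<le> ennreal C0 * local_mass q f x"
    using D_local [OF q] by blast
  \<comment> \<open>The area of the preimage of any unit disc under \<open>\<psi>\<close>, a disc of
    radius \<open>1 / norm a\<close>.\<close>
  define A where "A = pi * (1 / norm a)\<^sup>2"
  have A: "A > 0" using a by (simp add: A_def)
  have [measurable]: "\<psi> \<in> borel_measurable borel" by (rule entire_measurable [OF \<psi>])
  show ?thesis
  proof
    show "C0 * A > 0" using C0 A by simp
    fix f :: "complex \<Rightarrow> complex" assume f: "f holomorphic_on UNIV"
    have [measurable]: "gauss_abs f \<in> borel_measurable borel" by (rule gauss_abs_measurable [OF f])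
    \<comment> \<open>Written through \<open>dist\<close> instead of an indicator of a moving ball,
      the kernel is visibly measurable in both variables jointly.\<close>
    define k :: "complex \<Rightarrow> complex \<Rightarrow> ennreal" where "k = (\<lambda>z v. if dist (\<psi> z) v < 1 then 1 else 0)"
    have k_ind: "k z v = indicator (ball (\<psi> z) 1) v" for z v
      by (simp add: k_def indicator_def)
    have mk [measurable]: "case_prod k \<in> borel_measurable (lborel \<Otimes>\<^sub>M lborel)"
      unfolding k_def case_prod_unfold by measurable
    have "(\<integral>\<^sup>+ v. ennreal (N f v powr q) \<partial>lborel) \<le>
        (\<integral>\<^sup>+ z. ennreal C0 * (\<integral>\<^sup>+ v. k z v * ennreal (gauss_abs f v powr q) \<partial>lborel) \<partial>lborel)"
    proof (intro nn_integral_mono)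
      fix z
      have "local_mass q f (\<psi> z) = (\<integral>\<^sup>+ v. k z v * ennreal (gauss_abs f v powr q) \<partial>lborel)"
        unfolding local_mass_def k_ind by (intro nn_integral_cong) (rule mult.commute)
      then show "ennreal (N f z powr q) \<le> ennreal C0 * (\<integral>\<^sup>+ v. k z v * ennreal (gauss_abs f v powr q) \<partial>lborel)"
        using loc [OF f, of "\<psi> z"] by (simp add: N_def)
    qed
    also have "\<dots> = ennreal C0 * (\<integral>\<^sup>+ z. (\<integral>\<^sup>+ v. k z v * ennreal (gauss_abs f v powr q) \<partial>lborel) \<partial>lborel)"
    proof (rule nn_integral_cmult)
      have "(\<lambda>(z, v). k z v * ennreal (gauss_abs f v powr q)) \<in> borel_measurable (lborel \<Otimes>\<^sub>M lborel)"
        using mk by (simp add: case_prod_unfold)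
      then show "(\<lambda>z. \<integral>\<^sup>+ v. k z v * ennreal (gauss_abs f v powr q) \<partial>lborel) \<in> borel_measurable lborel"
        by (rule lborel.borel_measurable_nn_integral)
    qed
    also have "\<dots> \<le> ennreal C0 * (ennreal A * (\<integral>\<^sup>+ v. ennreal (gauss_abs f v powr q) \<partial>lborel))"
    proof (intro mult_left_mono nn_integral_schur mk)
      fix v :: complex
      have "(\<integral>\<^sup>+ z. k z v \<partial>lborel) \<le> (\<integral>\<^sup>+ z. indicator (ball ((v - b) / a) (1 / norm a)) z \<partial>lborel)"
      proof (intro nn_integral_mono)
        fix z
        have "a * z + b - v = a * (z - (v - b) / a)" using a by (simp add: field_simps)
        then have "dist (\<psi> z) v = norm a * dist ((v - b) / a) z"
          by (metis ab dist_norm norm_mult norm_minus_commute)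
        then show "k z v \<le> indicator (ball ((v - b) / a) (1 / norm a)) z"
          using a by (auto simp: k_def field_simps)
      qed
      also have "\<dots> = ennreal A"
        using a by (simp add: emeasure_ball unit_ball_vol_2 A_def)
      finally show "(\<integral>\<^sup>+ z. k z v \<partial>lborel) \<le> ennreal A" .
    qed auto
    also have "\<dots> = ennreal (C0 * A) * fock_mass q f"
      using C0 A by (simp add: fock_mass_def ennreal_mult mult.assoc)
    finally show "(\<integral>\<^sup>+ v. ennreal (N f v powr q) \<partial>lborel) \<le> ennreal (C0 * A) * fock_mass q f" .
  qed
qed

section \<open>Boundedness of the operator\<close>

lemma bounded_if:
  assumes K: "\<And>z. m z \<le> K"
  shows "fock_bounded p q T"
proof -
  have K0: "K \<ge> 0" using K [of 0] m_nonneg [of 0] by linarith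
  obtain C1 where C1: "C1 > 0" "\<And>f. f holomorphic_on UNIV \<Longrightarrow>
     fock_mass q (T f) \<le> ennreal C1 * (\<integral>\<^sup>+ v. ennreal ((N f v * m v) powr q) \<partial>lborel)"
    using T_mass by blast
  obtain C2 where C2: "C2 > 0" "\<And>f. f holomorphic_on UNIV \<Longrightarrow>
     (\<integral>\<^sup>+ v. ennreal (N f v powr q) \<partial>lborel) \<le> ennreal C2 * fock_mass q f"
    using N_integral [OF K] by blast
  obtain C3 where C3: "C3 > 0" "\<And>f. in_fock p f \<Longrightarrow> fock_mass q f \<le> ennreal (C3 * fock_norm p f powr q)"
    using fock_embedding [OF p pq] by blast
  \<comment> \<open>Chosen so that the final mass bound takes the form
    \<open>2 * pi / q * (E powr (1 / q) * fock_norm p f) powr q\<close> demanded by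
    \<open>in_fock_if_mass_le\<close>.\<close>
  define E where "E = C1 * (K powr q * (C2 * C3)) * q / (2 * pi)"
  have E: "E \<ge> 0" using C1 C2 C3 q by (simp add: E_def)
  show ?thesis unfolding fock_bounded_def
  proof (intro exI [of _ "E powr (1 / q)"] allI impI)
    fix f assume f: "in_fock p f"
    then have hol: "f holomorphic_on UNIV" by (simp add: in_fock_def)
    note [measurable] = N_measurable [OF hol]
    let ?n = "fock_norm p f"
    have "(\<integral>\<^sup>+ v. ennreal ((N f v * m v) powr q) \<partial>lborel) \<le> (\<integral>\<^sup>+ v. ennreal (K powr q) * ennreal (N f v powr q) \<partial>lborel)"
    proof (intro nn_integral_mono)
      fix v
      have "(N f v * m v) powr q \<le> (N f v * K) powr q"
        using q K by (intro powr_mono2 mult_left_mono) auto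
      also have "\<dots> = K powr q * N f v powr q" using K0 by (simp add: powr_mult)
      finally show "ennreal ((N f v * m v) powr q) \<le> ennreal (K powr q) * ennreal (N f v powr q)"
        by (simp add: ennreal_leI flip: ennreal_mult)
    qed
    also have "\<dots> = ennreal (K powr q) * (\<integral>\<^sup>+ v. ennreal (N f v powr q) \<partial>lborel)"
      by (rule nn_integral_cmult) measurable
    also have "\<dots> \<le> ennreal (K powr q) * (ennreal C2 * ennreal (C3 * ?n powr q))"
      by (intro mult_left_mono order_trans [OF C2(2) [OF hol]] C3(2) f) auto
    finally have "fock_mass q (T f) \<le> ennreal C1 * (ennreal (K powr q) * (ennreal C2 * ennreal (C3 * ?n powr q)))"
      by (intro order_trans [OF C1(2) [OF hol]] mult_left_mono) auto
    also have "\<dots> = ennreal (C1 * (K powr q * (C2 * (C3 * ?n powr q))))"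
      using C1 C2 C3 by (simp flip: ennreal_mult)
    also have "C1 * (K powr q * (C2 * (C3 * ?n powr q))) = 2 * pi / q * (E powr (1 / q) * ?n) powr q"
    proof -
      have "(E powr (1 / q) * ?n) powr q = E * ?n powr q"
        using E q by (simp add: powr_mult powr_powr)
      then show ?thesis using q by (simp add: E_def)
    qed
    finally have le: "fock_mass q (T f) \<le> ennreal (2 * pi / q * (E powr (1 / q) * ?n) powr q)" .
    show "in_fock q (T f) \<and> fock_norm q (T f) \<le> E powr (1 / q) * ?n"
      using in_fock_if_mass_le [OF q T_primitive(1) [OF hol] _ le] by simp
  qed
qed

lemma bounded_only_if:
  assumes "fock_bounded p q T"
  shows "\<exists>K. \<forall>z. m z \<le> K"
proof -
  obtain C where C: "\<And>f. in_fock p f \<Longrightarrow> in_fock q (T f)"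
    "\<And>f. in_fock p f \<Longrightarrow> fock_norm q (T f) \<le> C * fock_norm p f"
    using assms unfolding fock_bounded_def by blast
  obtain K where K: "K > 0"
    "\<And>f x. in_fock q f \<Longrightarrow> gauss_abs (deriv f) x / (1 + norm x) \<le> K * fock_norm q f"
    using fock_pointwise [OF q] by metis
  obtain B c where c: "0 < c"
    and test: "\<And>w. \<exists>f. in_fock p f \<and> fock_norm p f \<le> B \<and> c * \<omega> w \<le> gauss_abs (D f) w"
    using D_test by blast
  \<comment> \<open>\<open>fock_bounded\<close> does not fix the sign of \<open>C\<close>, so the
    bound \<open>B\<close> can be inserted only after passing to the absolute value.\<close>
  have "m z \<le> K * (\<bar>C\<bar> * B) / c" for z
  proof -
    obtain f where f: "in_fock p f" "fock_norm p f \<le> B" "c * \<omega> (\<psi> z) \<le> gauss_abs (D f) (\<psi> z)"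
      using test by blast
    have hol: "f holomorphic_on UNIV" using f by (simp add: in_fock_def)
    have "c \<le> N f z" using f(3) by (simp add: N_def pos_le_divide_eq)
    then have "c * m z \<le> N f z * m z" by (intro mult_right_mono) auto
    also have "\<dots> \<le> K * fock_norm q (T f)"
      using K(2) [OF C(1) [OF f(1)], of z] by (simp add: deriv_T [OF hol])
    also have "\<dots> \<le> K * (\<bar>C\<bar> * B)"
    proof (intro mult_left_mono)
      have "fock_norm q (T f) \<le> C * fock_norm p f" by (rule C(2) [OF f(1)])
      also have "\<dots> \<le> \<bar>C\<bar> * B" using f by (intro mult_mono) auto
      finally show "fock_norm q (T f) \<le> \<bar>C\<bar> * B" .
    qed (use K in auto)
    finally show ?thesis using c by (simp add: pos_le_divide_eq mult.commute)
  qed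
  then show ?thesis by blast
qed

section \<open>Compactness of the operator\<close>

lemma compact_only_if:
  assumes comp: "fock_compact p q T"
  shows "(m \<longlongrightarrow> 0) at_infinity"
proof (rule ccontr)
  assume "\<not> ?thesis"
  then obtain e where e: "e > 0" and "\<not> eventually (\<lambda>z. dist (m z) 0 < e) at_infinity"
    by (auto simp: tendsto_iff)
  then have "\<forall>n. \<exists>z. real n \<le> norm z \<and> e \<le> m z"
    by (auto simp: eventually_at_infinity not_less)
  then obtain z where z: "\<And>n. real n \<le> norm (z n)" "\<And>n. e \<le> m (z n)" by metis
  obtain B c where c: "0 < c"
    and test: "\<And>w. \<exists>f. in_fock p f \<and> fock_norm p f \<le> B \<and> c * \<omega> w \<le> gauss_abs (D f) w"
    using D_test by blast
  then obtain F where F: "\<And>w. in_fock p (F w)" "\<And>w. fock_norm p (F w) \<le> B"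
      "\<And>w. c * \<omega> w \<le> gauss_abs (D (F w)) w"
    by metis
  define fs where "fs = (\<lambda>n. F (\<psi> (z n)))"
  have "(\<forall>n. in_fock p (fs n)) \<and> (\<exists>B. \<forall>n. fock_norm p (fs n) \<le> B)"
    using F by (auto simp: fs_def)
  then obtain r h where r: "strict_mono r" and h: "in_fock q h"
    and lim: "(\<lambda>n. fock_norm q (\<lambda>z. T (fs (r n)) z - h z)) \<longlonglongrightarrow> 0"
    using comp unfolding fock_compact_def by blast
  have Tq: "in_fock q (T f)" if "in_fock p f" for f
    using comp that unfolding fock_compact_def by blast
  obtain K where K: "K > 0"
    "\<And>f x. in_fock q f \<Longrightarrow> gauss_abs (deriv f) x / (1 + norm x) \<le> K * fock_norm q f"
    using fock_pointwise [OF q] by metis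
  have "filterlim (\<lambda>n. z (r n)) at_infinity sequentially"
  proof -
    have "filterlim (\<lambda>n. norm (z (r n))) at_top sequentially"
    proof (rule filterlim_at_top_mono [OF filterlim_real_sequentially])
      show "eventually (\<lambda>n. real n \<le> norm (z (r n))) sequentially"
        using seq_suble [OF r] z(1) by (intro always_eventually) (meson of_nat_le_iff order_trans)
    qed
    then show ?thesis by (rule filterlim_norm_at_top_imp_at_infinity)
  qed
  then have lim_h: "(\<lambda>n. gauss_abs (deriv h) (z (r n)) / (1 + norm (z (r n)))) \<longlonglongrightarrow> 0"
    by (rule fock_deriv_vanishes_at_infinity [OF q h])
  \<comment> \<open>The contradiction is drawn at the points \<open>z (r n)\<close>, which tend to
    infinity, not at their images under \<open>\<psi>\<close>. The derivative of
    \<open>T (fs (r n))\<close> is split into that of the difference, controlled by a norm tending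
    to 0, and that of \<open>h\<close>, which vanishes at infinity.\<close>
  have le: "c * e \<le> K * fock_norm q (\<lambda>z. T (fs (r n)) z - h z)
       + gauss_abs (deriv h) (z (r n)) / (1 + norm (z (r n)))" for n
  proof -
    define f where "f = fs (r n)"
    define x where "x = z (r n)"
    have f: "in_fock p f" using F by (simp add: f_def fs_def)
    then have hol: "f holomorphic_on UNIV" by (simp add: in_fock_def)
    have hh: "h holomorphic_on UNIV" using h by (simp add: in_fock_def)
    have "c \<le> N f x"
      using F(3) [of "\<psi> x"] by (simp add: N_def f_def fs_def x_def pos_le_divide_eq)
    then have "c * e \<le> N f x * m x"
      using z(2) [of "r n"] c e by (intro mult_mono) (auto simp: x_def)
    also have "\<dots> = gauss_abs (deriv (T f)) x / (1 + norm x)" by (simp add: deriv_T [OF hol])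
    also have "\<dots> \<le> (gauss_abs (deriv (\<lambda>z. T f z - h z)) x + gauss_abs (deriv h) x) / (1 + norm x)"
    proof (intro divide_right_mono)
      have "deriv (\<lambda>z. T f z - h z) x = deriv (T f) x - deriv h x"
        using T_primitive(1) [OF hol] hh by (intro deriv_diff) (auto simp: holomorphic_on_def)
      then have "norm (deriv (T f) x) \<le> norm (deriv (\<lambda>z. T f z - h z) x) + norm (deriv h x)"
        using norm_triangle_ineq [of "deriv (T f) x - deriv h x" "deriv h x"] by simp
      then show "gauss_abs (deriv (T f)) x \<le> gauss_abs (deriv (\<lambda>z. T f z - h z)) x + gauss_abs (deriv h) x"
        unfolding gauss_abs_def distrib_right [symmetric] by (intro mult_right_mono) auto
    qed auto
    also have "\<dots> \<le> K * fock_norm q (\<lambda>z. T f z - h z) + gauss_abs (deriv h) x / (1 + norm x)"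
      using K(2) [OF fock_diff(1) [OF q Tq [OF f] h], of x] by (simp add: add_divide_distrib)
    finally show ?thesis by (simp add: f_def x_def)
  qed
  have "(\<lambda>n. K * fock_norm q (\<lambda>z. T (fs (r n)) z - h z)
       + gauss_abs (deriv h) (z (r n)) / (1 + norm (z (r n)))) \<longlonglongrightarrow> K * 0 + 0"
    by (intro tendsto_intros lim lim_h)
  then have "c * e \<le> K * 0 + 0"
    by (rule tendsto_lowerbound) (use le in auto)
  with c e show False by (simp add: mult_le_0_iff)
qed

text \<open>Far out, \<open>m\<close> is small and the mass of \<open>e n\<close> bounded. On the
  remaining disc, \<open>N (e n) v\<close> depends on \<open>e n\<close> only through the unit disc
  about \<open>\<psi> v\<close>, even when \<open>D\<close> is the derivative, so locally uniform
  convergence suffices.\<close>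

lemma T_mass_vanishes:
  assumes lim: "(m \<longlongrightarrow> 0) at_infinity"
    and e: "\<And>n. e n holomorphic_on UNIV" and A: "\<And>n. fock_mass q (e n) \<le> ennreal A"
    and unif: "\<And>R. uniform_limit (cball 0 R) e (\<lambda>_. 0) sequentially"
    and \<delta>: "\<delta> > 0"
  shows "eventually (\<lambda>n. fock_mass q (T (e n)) \<le> ennreal \<delta>) sequentially"
proof -
  obtain K where K: "\<And>z. m z \<le> K" using bounded_if_vanishes_at_infinity [OF m_cont lim] by blast
  have K0: "K \<ge> 0" using K [of 0] m_nonneg [of 0] by linarith
  obtain C1 where C1: "C1 > 0" "\<And>f. f holomorphic_on UNIV \<Longrightarrow>
     fock_mass q (T f) \<le> ennreal C1 * (\<integral>\<^sup>+ v. ennreal ((N f v * m v) powr q) \<partial>lborel)"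
    using T_mass by blast
  obtain C2 where C2: "C2 > 0" "\<And>f. f holomorphic_on UNIV \<Longrightarrow>
     (\<integral>\<^sup>+ v. ennreal (N f v powr q) \<partial>lborel) \<le> ennreal C2 * fock_mass q f"
    using N_integral [OF K] by blast
  obtain C0 where C0: "C0 > 0" and loc: "\<And>f x. f holomorphic_on UNIV \<Longrightarrow>
      ennreal ((gauss_abs (D f) x / \<omega> x) powr q) \<le> ennreal C0 * local_mass q f x"
    using D_local [OF q] by blast
  \<comment> \<open>\<open>ennreal A\<close> is 0 for negative \<open>A\<close>, so
    \<open>max A 0\<close> is its real counterpart.\<close>
  have "C1 * (C2 * max A 0) \<ge> 0" using C1 C2 by simp
  then obtain \<eta> where \<eta>: "\<eta> > 0" "C1 * (C2 * max A 0) * \<eta> powr q \<le> \<delta> / 2"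
    using exists_small_powr [of "C1 * (C2 * max A 0)" "\<delta> / 2" q] \<delta> q by auto
  have "eventually (\<lambda>z. m z < \<eta>) at_infinity" using lim \<eta>(1) by (rule order_tendstoD)
  then obtain R0 where R0: "\<And>z. R0 \<le> norm z \<Longrightarrow> m z < \<eta>" by (auto simp: eventually_at_infinity)
  define R where "R = max R0 0"
  have R: "R \<ge> 0" "\<And>z. R \<le> norm z \<Longrightarrow> m z < \<eta>" using R0 by (auto simp: R_def)
  have "bounded (\<psi> ` cball 0 R)"
    by (intro compact_imp_bounded compact_continuous_image entire_continuous_on [OF \<psi>]) auto
  then obtain R' where R': "\<forall>v\<in>cball 0 R. norm (\<psi> v) \<le> R'" by (auto simp: bounded_iff)
  define W where "W = C1 * (K powr q * (C0 * pi) * (pi * R\<^sup>2))"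
  have "W \<ge> 0" using C0 C1 by (simp add: W_def)
  then obtain \<epsilon> where \<epsilon>: "\<epsilon> > 0" "W * \<epsilon> powr q \<le> \<delta> / 2"
    using exists_small_powr [of W "\<delta> / 2" q] \<delta> q by auto
  \<comment> \<open>The radius \<open>R' + 1\<close> covers the unit discs about all
    \<open>\<psi> v\<close> with \<open>v\<close> in \<open>cball 0 R\<close>.\<close>
  have "eventually (\<lambda>n. \<forall>x\<in>cball 0 (R' + 1). dist (e n x) 0 < \<epsilon>) sequentially"
    using unif [of "R' + 1"] \<epsilon> by (auto simp: uniform_limit_iff)
  then show ?thesis
  proof eventually_elim
    case (elim n)
    note [measurable] = N_measurable [OF e [of n]]
    have inner: "ennreal ((N (e n) v * m v) powr q) \<le> ennreal (K powr q * (C0 * pi) * \<epsilon> powr q)"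
      if v: "v \<in> cball 0 R" for v
    proof -
      have "local_mass q (e n) (\<psi> v) \<le> ennreal (\<epsilon> powr q * pi)"
      proof (rule local_mass_le_sup [OF q])
        fix x assume "x \<in> ball (\<psi> v) 1"
        then have "norm x \<le> norm (\<psi> v) + 1"
          using norm_triangle_sub [of x "\<psi> v"] by (simp add: dist_norm norm_minus_commute)
        then have "x \<in> cball 0 (R' + 1)" using bspec [OF R' v] by simp
        then show "norm (e n x) \<le> \<epsilon>" using elim by (auto intro: less_imp_le)
      qed (use \<epsilon> in auto)
      then have "ennreal (N (e n) v powr q) \<le> ennreal C0 * ennreal (\<epsilon> powr q * pi)"
        unfolding N_def by (intro order_trans [OF loc [OF e]] mult_left_mono) auto
      also have "\<dots> = ennreal (C0 * (\<epsilon> powr q * pi))"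
        using C0 by (simp flip: ennreal_mult)
      finally have *: "N (e n) v powr q \<le> C0 * (\<epsilon> powr q * pi)"
        using C0 by (subst (asm) ennreal_le_iff) auto
      have "(N (e n) v * m v) powr q = m v powr q * N (e n) v powr q" by (simp add: powr_mult)
      also have "\<dots> \<le> K powr q * (C0 * (\<epsilon> powr q * pi))"
        using * K q by (intro mult_mono powr_mono2) auto
      finally show ?thesis by (simp add: ennreal_leI mult_ac)
    qed
    have "(\<integral>\<^sup>+ v. ennreal ((N (e n) v * m v) powr q) \<partial>lborel) \<le>
       (\<integral>\<^sup>+ v. ennreal (\<eta> powr q) * ennreal (N (e n) v powr q)
          + ennreal (K powr q * (C0 * pi) * \<epsilon> powr q) * indicator (cball 0 R) v \<partial>lborel)"
    proof (intro nn_integral_mono)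
      fix v
      show "ennreal ((N (e n) v * m v) powr q) \<le> ennreal (\<eta> powr q) * ennreal (N (e n) v powr q)
          + ennreal (K powr q * (C0 * pi) * \<epsilon> powr q) * indicator (cball 0 R) v"
      proof (cases "v \<in> cball 0 R")
        case True
        then show ?thesis using inner [OF True] by (simp add: add_increasing)
      next
        case False
        then have "m v \<le> \<eta>" using R(2) [of v] by simp
        then have "(N (e n) v * m v) powr q \<le> (\<eta> * N (e n) v) powr q"
          using q mult_left_mono [of "m v" \<eta> "N (e n) v"] by (intro powr_mono2) (auto simp: mult.commute)
        also have "\<dots> = \<eta> powr q * N (e n) v powr q" using \<eta> by (simp add: powr_mult)
        finally have "ennreal ((N (e n) v * m v) powr q) \<le> ennreal (\<eta> powr q) * ennreal (N (e n) v powr q)"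
          by (simp add: ennreal_leI flip: ennreal_mult)
        then show ?thesis using False by simp
      qed
    qed
    also have "\<dots> = ennreal (\<eta> powr q) * (\<integral>\<^sup>+ v. ennreal (N (e n) v powr q) \<partial>lborel)
          + ennreal (K powr q * (C0 * pi) * \<epsilon> powr q) * ennreal (pi * R\<^sup>2)"
    proof -
      have [measurable]: "cball (0::complex) R \<in> sets borel" by simp
      have "emeasure lborel (cball (0::complex) R) = ennreal (pi * R\<^sup>2)"
        using R(1) by (simp add: emeasure_cball unit_ball_vol_2)
      then have "(\<integral>\<^sup>+ v. ennreal (K powr q * (C0 * pi) * \<epsilon> powr q) * indicator (cball (0::complex) R) v \<partial>lborel)
          = ennreal (K powr q * (C0 * pi) * \<epsilon> powr q) * ennreal (pi * R\<^sup>2)"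
        by (subst nn_integral_cmult_indicator) auto
      moreover have "(\<integral>\<^sup>+ v. ennreal (\<eta> powr q) * ennreal (N (e n) v powr q) \<partial>lborel)
          = ennreal (\<eta> powr q) * (\<integral>\<^sup>+ v. ennreal (N (e n) v powr q) \<partial>lborel)"
        by (rule nn_integral_cmult) measurable
      moreover have "(\<integral>\<^sup>+ v. ennreal (\<eta> powr q) * ennreal (N (e n) v powr q)
            + ennreal (K powr q * (C0 * pi) * \<epsilon> powr q) * indicator (cball 0 R) v \<partial>lborel)
          = (\<integral>\<^sup>+ v. ennreal (\<eta> powr q) * ennreal (N (e n) v powr q) \<partial>lborel)
            + (\<integral>\<^sup>+ v. ennreal (K powr q * (C0 * pi) * \<epsilon> powr q) * indicator (cball (0::complex) R) v \<partial>lborel)"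
        by (rule nn_integral_add) measurable
      ultimately show ?thesis by (simp only:)
    qed
    also have "\<dots> \<le> ennreal (\<eta> powr q) * (ennreal C2 * ennreal (max A 0))
          + ennreal (K powr q * (C0 * pi) * \<epsilon> powr q) * ennreal (pi * R\<^sup>2)"
    proof (intro add_right_mono mult_left_mono order_trans [OF C2(2) [OF e]])
      show "fock_mass q (e n) \<le> ennreal (max A 0)"
        using A [of n] by (rule order_trans) (simp add: ennreal_leI)
    qed auto
    finally have "fock_mass q (T (e n)) \<le> ennreal C1 * (ennreal (\<eta> powr q) * (ennreal C2 * ennreal (max A 0))
          + ennreal (K powr q * (C0 * pi) * \<epsilon> powr q) * ennreal (pi * R\<^sup>2))"
      by (intro order_trans [OF C1(2) [OF e]] mult_left_mono) auto
    also have "\<dots> = ennreal (C1 * (\<eta> powr q * (C2 * max A 0) + K powr q * (C0 * pi) * \<epsilon> powr q * (pi * R\<^sup>2)))"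
      using C0 C1 C2 by (simp flip: ennreal_mult ennreal_plus)
    also have "C1 * (\<eta> powr q * (C2 * max A 0) + K powr q * (C0 * pi) * \<epsilon> powr q * (pi * R\<^sup>2)) =
        C1 * (C2 * max A 0) * \<eta> powr q + W * \<epsilon> powr q"
      by (simp add: W_def algebra_simps)
    also have "ennreal \<dots> \<le> ennreal \<delta>" using \<eta>(2) \<epsilon>(2) by (intro ennreal_leI) simp
    finally show ?case .
  qed
qed

lemma compact_if:
  assumes lim: "(m \<longlongrightarrow> 0) at_infinity"
  shows "fock_compact p q T"
proof -
  have bdd: "fock_bounded p q T"
    using bounded_if bounded_if_vanishes_at_infinity [OF m_cont lim] by blast
  then have Tq: "in_fock q (T f)" if "in_fock p f" for f
    using that by (auto simp: fock_bounded_def)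
  show ?thesis unfolding fock_compact_def
  proof (intro conjI allI impI Tq)
    fix fs :: "nat \<Rightarrow> complex \<Rightarrow> complex"
    assume "(\<forall>n. in_fock p (fs n)) \<and> (\<exists>B. \<forall>n. fock_norm p (fs n) \<le> B)"
    then obtain B where fs: "\<And>n. in_fock p (fs n)" and B: "\<And>n. fock_norm p (fs n) \<le> B" by blast
    have B0: "B \<ge> 0" using B [of 0] fock_norm_nonneg order_trans by blast
    have hol: "fs n holomorphic_on UNIV" for n using fs [of n] by (simp add: in_fock_def)
    obtain K where K: "K > 0" "\<And>f x. in_fock p f \<Longrightarrow> gauss_abs f x \<le> K * fock_norm p f"
      using fock_pointwise [OF p] by metis
    obtain g r where g: "g holomorphic_on UNIV" and r: "strict_mono (r :: nat \<Rightarrow> nat)"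
      and pw: "\<And>x. (\<lambda>n. fs (r n) x) \<longlonglongrightarrow> g x"
      and un: "\<And>S. compact S \<Longrightarrow> uniform_limit S (fs \<circ> r) g sequentially"
    proof (rule Montel [of UNIV "range fs" fs])
      fix S :: "complex set" assume "compact S"
      then obtain \<rho> where \<rho>: "\<forall>x\<in>S. norm x \<le> \<rho>" using compact_imp_bounded bounded_iff by metis
      have "norm (fs n x) \<le> K * B * exp (\<rho>\<^sup>2 / 2)" if "x \<in> S" for n x
      proof -
        have "norm (fs n x) = gauss_abs (fs n) x * exp ((norm x)\<^sup>2 / 2)"
          by (simp add: gauss_abs_def mult.assoc flip: exp_add)
        also have "\<dots> \<le> K * B * exp (\<rho>\<^sup>2 / 2)"
        proof (intro mult_mono)
          have "gauss_abs (fs n) x \<le> K * fock_norm p (fs n)" by (rule K(2) [OF fs])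
          also have "\<dots> \<le> K * B" using K B by (intro mult_left_mono) auto
          finally show "gauss_abs (fs n) x \<le> K * B" .
          show "exp ((norm x)\<^sup>2 / 2) \<le> exp (\<rho>\<^sup>2 / 2)"
            using bspec [OF \<rho> that] by (simp add: power_mono)
        qed (use K B0 in auto)
        finally show ?thesis .
      qed
      then show "\<exists>B. \<forall>h\<in>range fs. \<forall>z\<in>S. norm (h z) \<le> B" by blast
    qed (use hol in auto)
    \<comment> \<open>Montel gives only locally uniform convergence, so the norm bound reaches the
      limit through Fatou's lemma.\<close>
    have "fock_mass p g \<le> ennreal (2 * pi / p * B powr p)"
    proof -
      have meas: "(\<lambda>z. ennreal (gauss_abs (fs (r n)) z powr p)) \<in> borel_measurable lborel" for n
        using gauss_abs_measurable [OF hol, of "r n"] by measurable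
      have ptw: "(\<lambda>n. ennreal (gauss_abs (fs (r n)) z powr p)) \<longlonglongrightarrow> ennreal (gauss_abs g z powr p)" for z
      proof -
        have "(\<lambda>n. gauss_abs (fs (r n)) z) \<longlonglongrightarrow> gauss_abs g z"
          unfolding gauss_abs_def by (intro tendsto_intros pw)
        then have "(\<lambda>n. gauss_abs (fs (r n)) z powr p) \<longlonglongrightarrow> gauss_abs g z powr p"
          using p by (intro tendsto_powr2 [OF _ tendsto_const]) auto
        then show ?thesis by (intro tendsto_ennrealI)
      qed
      have "fock_mass p g = (\<integral>\<^sup>+ z. liminf (\<lambda>n. ennreal (gauss_abs (fs (r n)) z powr p)) \<partial>lborel)"
        unfolding fock_mass_def
        by (intro nn_integral_cong lim_imp_Liminf [symmetric] ptw) auto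
      also have "\<dots> \<le> liminf (\<lambda>n. fock_mass p (fs (r n)))"
        unfolding fock_mass_def by (intro nn_integral_liminf meas)
      also have "\<dots> \<le> liminf (\<lambda>n. ennreal (2 * pi / p * B powr p))"
      proof (intro Liminf_mono always_eventually allI)
        fix n
        show "fock_mass p (fs (r n)) \<le> ennreal (2 * pi / p * B powr p)"
          unfolding fock_mass_eq_norm [OF p fs] using p B
          by (intro ennreal_leI mult_left_mono powr_mono2) auto
      qed
      also have "\<dots> = ennreal (2 * pi / p * B powr p)"
        by (intro Liminf_const) simp
      finally show ?thesis .
    qed
    then have gp: "in_fock p g" "fock_norm p g \<le> B"
      using in_fock_if_mass_le [OF p g B0] by auto
    define e where "e = (\<lambda>n z. fs (r n) z - g z)"
    have e_hol: "e n holomorphic_on UNIV" for n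
      unfolding e_def by (intro holomorphic_intros hol g)
    obtain C3 where C3: "C3 > 0" "\<And>f. in_fock p f \<Longrightarrow> fock_mass q f \<le> ennreal (C3 * fock_norm p f powr q)"
      using fock_embedding [OF p pq] by blast
    define B' where "B' = 2 * (B powr p + B powr p) powr (1 / p)"
    have e_mass: "fock_mass q (e n) \<le> ennreal (C3 * B' powr q)" for n
    proof -
      have "in_fock p (e n)" unfolding e_def by (rule fock_diff(1) [OF p fs gp(1)])
      moreover have "fock_norm p (e n) \<le> B'"
      proof -
        have "fock_norm p (e n) \<le> 2 * (fock_norm p (fs (r n)) powr p + fock_norm p g powr p) powr (1 / p)"
          unfolding e_def by (rule fock_diff(2) [OF p fs gp(1)])
        also have "\<dots> \<le> B'"
          unfolding B'_def using p B gp(2)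
          by (intro mult_left_mono powr_mono2 add_mono add_nonneg_nonneg) auto
        finally show ?thesis .
      qed
      ultimately show ?thesis
        using C3 q by (intro order_trans [OF C3(2)] ennreal_leI mult_left_mono powr_mono2) auto
    qed
    have e_unif: "uniform_limit (cball 0 R) e (\<lambda>_. 0) sequentially" for R
      using un [OF compact_cball, of 0 R] by (simp add: uniform_limit_iff e_def dist_norm)
    have "(\<lambda>n. fock_norm q (\<lambda>z. T (fs (r n)) z - T g z)) \<longlonglongrightarrow> 0"
    proof (rule tendstoI)
      fix \<epsilon> :: real assume \<epsilon>: "\<epsilon> > 0"
      have "2 * pi / q * (\<epsilon> / 2) powr q > 0" using q \<epsilon> by simp
      then have "eventually (\<lambda>n. fock_mass q (T (e n)) \<le> ennreal (2 * pi / q * (\<epsilon> / 2) powr q)) sequentially"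
        by (rule T_mass_vanishes [OF lim e_hol e_mass e_unif])
      then show "eventually (\<lambda>n. dist (fock_norm q (\<lambda>z. T (fs (r n)) z - T g z)) 0 < \<epsilon>) sequentially"
      proof eventually_elim
        case (elim n)
        have "fock_norm q (T (e n)) \<le> \<epsilon> / 2"
          by (rule in_fock_if_mass_le(2) [OF q T_primitive(1) [OF e_hol] _ elim]) (use \<epsilon> in simp)
        moreover have "(\<lambda>z. T (fs (r n)) z - T g z) = T (e n)"
          unfolding e_def by (rule ext) (rule T_diff [OF hol g])
        ultimately show ?case using \<epsilon> by simp
      qed
    qed
    then show "\<exists>r h. strict_mono r \<and> in_fock q h \<and>
        (\<lambda>n. fock_norm q (\<lambda>z. T (fs (r n)) z - h z)) \<longlonglongrightarrow> 0"
      using r Tq [OF gp(1)] by blast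
  qed
qed

lemma bounded_iff_ess_bounded: "fock_bounded p q T \<longleftrightarrow> ess_bounded m"
  unfolding ess_bounded_continuous_iff [OF m_cont m_nonneg]
  using bounded_if bounded_only_if by blast

lemma compact_iff_vanishes: "fock_compact p q T \<longleftrightarrow> (m \<longlongrightarrow> 0) at_infinity"
  using compact_if compact_only_if by blast

end

section \<open>The two concrete operators\<close>

lemma gauss_abs_kernel:
  "gauss_abs (\<lambda>z. exp (cnj w * z - of_real ((norm w)\<^sup>2 / 2))) w = 1"
proof -
  have "Re (cnj w * w) = (norm w)\<^sup>2" unfolding cmod_power2 by (simp add: power2_eq_square)
  then show ?thesis by (simp add: gauss_abs_def field_simps flip: exp_add)
qed

lemma volterra_type_id:
  assumes "0 < p" "p \<le> q" "u holomorphic_on UNIV" "\<exists>z. u z \<noteq> 0"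
    "\<psi> holomorphic_on UNIV" "\<not> (\<exists>c. \<forall>z. \<psi> z = c)"
  shows "volterra_type p q (\<lambda>f. f) (\<lambda>_. 1) u \<psi>"
proof
  show "\<exists>C>0. \<forall>f x. f holomorphic_on UNIV \<longrightarrow>
      ennreal ((gauss_abs f x / 1) powr s) \<le> ennreal C * local_mass s f x" if "s > 0" for s
    using fock_local_bound [OF that] by (metis div_by_1)
  obtain B where "\<And>w. in_fock p (\<lambda>z. exp (cnj w * z - of_real ((norm w)\<^sup>2 / 2)))"
    "\<And>w. fock_norm p (\<lambda>z. exp (cnj w * z - of_real ((norm w)\<^sup>2 / 2))) \<le> B"
    using gaussian_in_fock [OF assms(1)] by metis
  then have "(0::real) < 1 \<and> (\<forall>w. \<exists>f. in_fock p f \<and> fock_norm p f \<le> B \<and> 1 * 1 \<le> gauss_abs f w)"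
    using gauss_abs_kernel by (metis mult_1 order_refl zero_less_one)
  then show "\<exists>B c. 0 < c \<and> (\<forall>w. \<exists>f. in_fock p f \<and> fock_norm p f \<le> B \<and> c * 1 \<le> gauss_abs f w)"
    by blast
qed (use assms in auto)

text \<open>Near \<open>w = 0\<close> the derivative of the kernel function degenerates, and the identity replaces it.\<close>

lemma volterra_type_deriv:
  assumes "0 < p" "p \<le> q" "u holomorphic_on UNIV" "\<exists>z. u z \<noteq> 0"
    "\<psi> holomorphic_on UNIV" "\<not> (\<exists>c. \<forall>z. \<psi> z = c)"
  shows "volterra_type p q deriv (\<lambda>x. 1 + norm x) u \<psi>"
proof
  show "\<exists>C>0. \<forall>f x. f holomorphic_on UNIV \<longrightarrow>
      ennreal ((gauss_abs (deriv f) x / (1 + norm x)) powr s) \<le> ennreal C * local_mass s f x" if "s > 0" for s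
    using fock_local_bound [OF that] by metis
  show "deriv (\<lambda>z. f z - h z) x = deriv f x - deriv h x"
    if "f holomorphic_on UNIV" "h holomorphic_on UNIV" for f h :: "complex \<Rightarrow> complex" and x
    using that by (intro deriv_diff) (auto simp: holomorphic_on_def)
  show "deriv f holomorphic_on UNIV" if "f holomorphic_on UNIV" for f :: "complex \<Rightarrow> complex"
    using that by (intro holomorphic_deriv) auto
  define k where "k = (\<lambda>w z. exp (cnj w * z - of_real ((norm w)\<^sup>2 / 2)))"
  obtain B where B: "\<And>w. in_fock p (k w)" "\<And>w. fock_norm p (k w) \<le> B"
    "in_fock p (\<lambda>z. z)" "fock_norm p (\<lambda>z. z) \<le> B"
    unfolding k_def using gaussian_in_fock [OF assms(1)] by metis
  \<comment> \<open>For \<open>norm w < 1\<close> the identity has weighted derivative at least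
    \<open>exp (- 1 / 2)\<close>, while \<open>1 + norm w < 2\<close>. For
    \<open>norm w \<ge> 1\<close> the kernel gives \<open>norm w\<close>, and
    \<open>c \<le> 1 / 2\<close> is enough.\<close>
  define c :: real where "c = exp (- 1 / 2) / 2"
  have c: "0 < c" "c \<le> 1 / 2" by (auto simp: c_def)
  have "\<exists>f. in_fock p f \<and> fock_norm p f \<le> B \<and> c * (1 + norm w) \<le> gauss_abs (deriv f) w" for w
  proof (cases "norm w \<ge> 1")
    case True
    have "deriv (k w) w = cnj w * k w w"
      unfolding k_def by (rule DERIV_imp_deriv) (auto intro!: derivative_eq_intros)
    then have "gauss_abs (deriv (k w)) w = norm w * gauss_abs (k w) w"
      by (simp add: gauss_abs_def norm_mult)
    then have "gauss_abs (deriv (k w)) w = norm w"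
      unfolding k_def gauss_abs_kernel by simp
    moreover have "c * (1 + norm w) \<le> 1 / 2 * (2 * norm w)"
      using True c by (intro mult_mono) auto
    ultimately show ?thesis using B by (intro exI [of _ "k w"]) auto
  next
    case False
    have "(norm w)\<^sup>2 \<le> 1" using False by (simp add: power_le_one)
    then have "exp (- 1 / 2) \<le> exp (- (norm w)\<^sup>2 / 2)" by simp
    moreover have "c * (1 + norm w) \<le> c * 2"
      using False c by (intro mult_left_mono) auto
    moreover have "c * 2 = exp (- 1 / 2)" by (simp add: c_def)
    ultimately have "c * (1 + norm w) \<le> exp (- (norm w)\<^sup>2 / 2)" by argo
    then have "c * (1 + norm w) \<le> gauss_abs (deriv (\<lambda>z. z)) w"
      by (simp add: gauss_abs_def)
    then show ?thesis using B by blast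
  qed
  then show "\<exists>B c. 0 < c \<and>
      (\<forall>w. \<exists>f. in_fock p f \<and> fock_norm p f \<le> B \<and> c * (1 + norm w) \<le> gauss_abs (deriv f) w)"
    using c by blast
  show "continuous_on UNIV (\<lambda>x::complex. 1 + norm x)" by (intro continuous_intros)
qed (use assms in auto)

theorem theorem1:
  fixes p q :: real and g \<psi> :: "complex \<Rightarrow> complex"
  assumes "0 < p" and "p \<le> q"
    and "g holomorphic_on UNIV" and "\<psi> holomorphic_on UNIV"
    and "\<not> (\<exists>c. \<forall>z. g z = c)" and "\<not> (\<exists>c. \<forall>z. \<psi> z = c)"
  shows "(fock_bounded p q (V_op g \<psi>) \<longleftrightarrow> ess_bounded (M_fun g \<psi>))
       \<and> (fock_compact p q (V_op g \<psi>) \<longleftrightarrow> ((M_fun g \<psi>) \<longlongrightarrow> 0) at_infinity)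
       \<and> (fock_bounded p q (J_op g \<psi>) \<longleftrightarrow> ess_bounded (Mt_fun g \<psi>))
       \<and> (fock_compact p q (J_op g \<psi>) \<longleftrightarrow> ((Mt_fun g \<psi>) \<longlongrightarrow> 0) at_infinity)"
proof -
  have g': "deriv g holomorphic_on UNIV" using assms(3) by (intro holomorphic_deriv) auto
  \<comment> \<open>Here nonconstancy of \<open>g\<close> becomes the requirement that the
    multiplier \<open>u\<close> is not identically zero.\<close>
  have "\<exists>z. deriv g z \<noteq> 0"
  proof (rule ccontr)
    assume "\<nexists>z. deriv g z \<noteq> 0"
    then have "\<exists>c. \<forall>z\<in>UNIV. g z = c"
      using holomorphic_derivI [OF assms(3)]
      by (intro has_field_derivative_zero_constant) auto
    with assms(5) show False by blast
  qed
  then interpret V: volterra_type p q "\<lambda>f. f" "\<lambda>_. 1" "deriv g" \<psi>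
    using assms g' by (intro volterra_type_id)
  interpret J: volterra_type p q deriv "\<lambda>x. 1 + norm x" g \<psi>
    using assms by (intro volterra_type_deriv) auto
  have "V.T = V_op g \<psi>" "J.T = J_op g \<psi>"
    by (intro ext; simp add: V.T_def J.T_def V_op_def J_op_def)+
  moreover have "V.m = M_fun g \<psi>" "J.m = Mt_fun g \<psi>"
    by (intro ext; simp add: V.m_def J.m_def M_fun_def Mt_fun_def)+
  ultimately show ?thesis
    using V.bounded_iff_ess_bounded V.compact_iff_vanishes
      J.bounded_iff_ess_bounded J.compact_iff_vanishes by simp
qed

end
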